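(* Let $a$ be the form defined by $\operatorname{dom}a:=\operatorname{dom}J$, $a[u]:=\mathcal E[u]$ for $u\in\operatorname{dom}J$, and let $A$ be the operator in $\mathcal H_{\mathrm{aux}}$ associated with $(a,J)$ in the sense of Arendt and ter Elst. Then $A=\check H$.
   Context: Let $\mathcal H,\mathcal H_{\mathrm{aux}}$ be Hilbert spaces, with scalar product $(\cdot,\cdot)_{\mathrm{aux}}$ on $\mathcal H_{\mathrm{aux}}$. Let $\mathcal E$ be a closed positive (i.e. symmetric, nonnegative) quadratic form with domain $\mathcal D\subseteq\mathcal H$; write $\mathcal E(\cdot,\cdot)$ for the associated sesquilinear form, $\mathcal E[u]:=\mathcal E(u,u)$, and $\mathcal E_\lambda[u]:=\mathcal E[u]+\lambda\|u\|^2$ for $\lambda>0$. Let $J\colon\operatorname{dom}J\subseteq\mathcal D\to\mathcal H_{\mathrm{aux}}$ be a linear operator with dense range which is closed as an operator from $(\mathcal D,\mathcal E_1^{1/2})$ to $\mathcal H_{\mathrm{aux}}$. For $\lambda>0$ let $P_\lambda$ be the $\mathcal E_\lambda$-orthogonal projection in the Hilbert space $(\mathcal D,\mathcal E_\lambda^{1/2})$ onto the $\mathcal E_\lambda$-orthogonal complement of $\ker J$. Define the closed positive densely defined quadratic form $\check{\mathcal E}_\lambda$ in $\mathcal H_{\mathrm{aux}}$ by $\operatorname{dom}\check{\mathcal E}_\lambda:=\operatorname{ran}J$, $\check{\mathcal E}_\lambda[Ju]:=\mathcal E_\lambda[P_\lambda u]$ for $u\in\operatorname{dom}J$, and let $\check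 H_\lambda$ be the associated positive self-adjoint operator in $\mathcal H_{\mathrm{aux}}$. The operator $\check H$ is the (existing and unique) positive self-adjoint operator in $\mathcal H_{\mathrm{aux}}$ such that $(\check H_\lambda+1)^{-1}\to(\check H+1)^{-1}$ strongly as $\lambda\downarrow 0$. Operator associated with $(a,J)$ (Arendt–ter Elst): the polarized form is $a(u,v)=\mathcal E(u,v)$, $u,v\in\operatorname{dom}J$. For $x,f\in\mathcal H_{\mathrm{aux}}$ one has $x\in\operatorname{dom}A$ and $Ax=f$ if and only if there exists a sequence $(u_n)$ in $\operatorname{dom}a$ such that (i) $Ju_n\to x$ weakly in $\mathcal H_{\mathrm{aux}}$, (ii) $\sup_n \operatorname{Re} a[u_n]<\infty$, and (iii) $\lim_{n\to\infty}a(u_n,v)=(f,Jv)_{\mathrm{aux}}$ for all $v\in\operatorname{dom}a$. (It is known that this defines an operator $A$.) *)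

theory Defs
  imports "HOL-Analysis.Analysis"
begin

text \<open>
  Complex Hilbert spaces. The inner product is linear in the first and conjugate-linear in the
  second argument. Positive definiteness is contained in \<open>cinner_norm\<close>, since \<open>norm\<close> is a norm.
\<close>

class complex_inner_space = real_normed_vector +
  fixes scaleC :: "complex \<Rightarrow> 'a \<Rightarrow> 'a"
    and cinner :: "'a \<Rightarrow> 'a \<Rightarrow> complex"
  assumes scaleC_add_right: "scaleC c (x + y) = scaleC c x + scaleC c y"
    and scaleC_add_left: "scaleC (c + d) x = scaleC c x + scaleC d x"
    and scaleC_scaleC: "scaleC c (scaleC d x) = scaleC (c * d) x"
    and scaleR_scaleC: "scaleR r x = scaleC (complex_of_real r) x"
    and cinner_commute: "cinner x y = cnj (cinner y x)"
    and cinner_add_left: "cinner (x + y) z = cinner x z + cinner y z"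
    and cinner_scaleC_left: "cinner (scaleC c x) y = c * cinner x y"
    and cinner_norm: "cinner x x = complex_of_real ((norm x)\<^sup>2)"

class complex_hilbert_space = complex_inner_space + complete_space

instantiation complex :: complex_hilbert_space
begin

definition scaleC_complex :: "complex \<Rightarrow> complex \<Rightarrow> complex"
  where "scaleC_complex c x = c * x"

definition cinner_complex :: "complex \<Rightarrow> complex \<Rightarrow> complex"
  where "cinner_complex x y = x * cnj y"

instance
  by standard
    (auto simp: scaleC_complex_def cinner_complex_def algebra_simps scaleR_conv_of_real
      complex_norm_square simp del: of_real_power)

end

definition csubspace :: "'a::complex_inner_space set \<Rightarrow> bool"
  where "csubspace S \<longleftrightarrow>
    0 \<in> S \<and> (\<forall>x\<in>S. \<forall>y\<in>S. x + y \<in> S) \<and> (\<forall>c. \<forall>x\<in>S. scaleC c x \<in> S)"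

definition clinear_on ::
    "'a::complex_inner_space set \<Rightarrow> ('a \<Rightarrow> 'b::complex_inner_space) \<Rightarrow> bool"
  where "clinear_on S f \<longleftrightarrow>
    (\<forall>x\<in>S. \<forall>y\<in>S. f (x + y) = f x + f y) \<and> (\<forall>c. \<forall>x\<in>S. f (scaleC c x) = scaleC c (f x))"

definition weakly_tendsto :: "(nat \<Rightarrow> 'a::complex_inner_space) \<Rightarrow> 'a \<Rightarrow> bool"
  where "weakly_tendsto x l \<longleftrightarrow> (\<forall>y. (\<lambda>n. cinner (x n) y) \<longlonglongrightarrow> cinner l y)"

text \<open>
  A quadratic form is given by its domain \<open>D\<close> and a function \<open>q\<close>, of which only the values on
  \<open>D\<close> matter. As \<open>q\<close> is real-valued, the underlying sesquilinear form is automatically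
  symmetric; it is recovered from \<open>q\<close> by polarization. The domain need not be dense.
\<close>

definition sesquilinear_on :: "'a::complex_inner_space set \<Rightarrow> ('a \<Rightarrow> 'a \<Rightarrow> complex) \<Rightarrow> bool"
  where "sesquilinear_on D t \<longleftrightarrow>
    (\<forall>x\<in>D. \<forall>y\<in>D. \<forall>z\<in>D. t (x + y) z = t x z + t y z \<and> t z (x + y) = t z x + t z y) \<and>
    (\<forall>c. \<forall>x\<in>D. \<forall>y\<in>D. t (scaleC c x) y = c * t x y \<and> t x (scaleC c y) = cnj c * t x y)"

definition positive_form :: "'a::complex_inner_space set \<Rightarrow> ('a \<Rightarrow> real) \<Rightarrow> bool"
  where "positive_form D q \<longleftrightarrow>
    csubspace D \<and>
    (\<exists>t. sesquilinear_on D t \<and> (\<forall>u\<in>D. t u u = complex_of_real (q u))) \<and>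
    (\<forall>u\<in>D. 0 \<le> q u)"

definition polarize :: "('a::complex_inner_space \<Rightarrow> real) \<Rightarrow> 'a \<Rightarrow> 'a \<Rightarrow> complex"
  where "polarize q u v =
    (complex_of_real (q (u + v)) - complex_of_real (q (u - v))
      + \<i> * complex_of_real (q (u + scaleC \<i> v))
      - \<i> * complex_of_real (q (u - scaleC \<i> v))) / 4"

definition form_shift :: "('a::complex_inner_space \<Rightarrow> real) \<Rightarrow> real \<Rightarrow> 'a \<Rightarrow> real"
  where "form_shift q l u = q u + l * (norm u)\<^sup>2"

text \<open>Closedness is completeness of \<open>D\<close> with respect to the norm \<open>sqrt (form_shift q 1 u)\<close>.\<close>

definition closed_form :: "'a::complex_inner_space set \<Rightarrow> ('a \<Rightarrow> real) \<Rightarrow> bool"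
  where "closed_form D q \<longleftrightarrow>
    (\<forall>u::nat \<Rightarrow> 'a.
      (\<forall>n. u n \<in> D) \<and> (\<forall>e>0. \<exists>N. \<forall>m\<ge>N. \<forall>n\<ge>N. sqrt (form_shift q 1 (u m - u n)) < e)
      \<longrightarrow> (\<exists>v\<in>D. (\<lambda>n. sqrt (form_shift q 1 (u n - v))) \<longlonglongrightarrow> 0))"

definition form_closed_operator ::
    "'a::complex_inner_space set \<Rightarrow> ('a \<Rightarrow> real) \<Rightarrow> 'a set \<Rightarrow> ('a \<Rightarrow> 'b::complex_inner_space) \<Rightarrow> bool"
  where "form_closed_operator D q domJ J \<longleftrightarrow>
    (\<forall>(u::nat \<Rightarrow> 'a) v y.
      (\<forall>n. u n \<in> domJ) \<and> v \<in> D \<and>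
      (\<lambda>n. sqrt (form_shift q 1 (u n - v))) \<longlonglongrightarrow> 0 \<and> (\<lambda>n. J (u n)) \<longlonglongrightarrow> y
      \<longrightarrow> v \<in> domJ \<and> J v = y)"

text \<open>
  An operator in a Hilbert space is identified with its graph. The graph of an adjoint is always a
  linear subspace, so a self-adjoint operator is in particular linear.
\<close>

definition adjoint_graph :: "('a::complex_inner_space \<times> 'a) set \<Rightarrow> ('a \<times> 'a) set"
  where "adjoint_graph T = {(y, z). \<forall>(x, w)\<in>T. cinner w y = cinner x z}"

definition self_adjoint :: "('a::complex_inner_space \<times> 'a) set \<Rightarrow> bool"
  where "self_adjoint T \<longleftrightarrow>
    single_valued T \<and> closure (Domain T) = UNIV \<and> adjoint_graph T = T"

definition positive_self_adjoint :: "('a::complex_inner_space \<times> 'a) set \<Rightarrow> bool"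
  where "positive_self_adjoint T \<longleftrightarrow>
    self_adjoint T \<and> (\<forall>(x, y)\<in>T. cinner y x \<in> \<real> \<and> 0 \<le> Re (cinner y x))"

text \<open>\<open>(T + 1)\<^sup>-\<^sup>1 f\<close>: the solution \<open>x\<close> of \<open>T x + x = f\<close>, that is, of \<open>T x = f - x\<close>.\<close>

definition resolvent1 :: "('a::complex_inner_space \<times> 'a) set \<Rightarrow> 'a \<Rightarrow> 'a"
  where "resolvent1 T f = (THE x. (x, f - x) \<in> T)"

text \<open>The operator of a densely defined closed positive form (first representation theorem).\<close>

definition form_operator :: "'a::complex_inner_space set \<Rightarrow> ('a \<Rightarrow> real) \<Rightarrow> ('a \<times> 'a) set"
  where "form_operator D q = {(x, f). x \<in> D \<and> (\<forall>v\<in>D. polarize q x v = cinner f v)}"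

definition arendt_ter_elst_operator ::
    "'a::complex_inner_space set \<Rightarrow> ('a \<Rightarrow> 'a \<Rightarrow> complex) \<Rightarrow> ('a \<Rightarrow> 'b::complex_inner_space)
      \<Rightarrow> ('b \<times> 'b) set"
  where "arendt_ter_elst_operator dom_a a J =
    {(x, f). \<exists>u::nat \<Rightarrow> 'a.
      (\<forall>n. u n \<in> dom_a) \<and>
      weakly_tendsto (\<lambda>n. J (u n)) x \<and>
      bdd_above (range (\<lambda>n. Re (a (u n) (u n)))) \<and>
      (\<forall>v\<in>dom_a. (\<lambda>n. a (u n) v) \<longlonglongrightarrow> cinner f (J v))}"

definition form_orthogonal ::
    "'a::complex_inner_space set \<Rightarrow> ('a \<Rightarrow> real) \<Rightarrow> 'a set \<Rightarrow> 'a set"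
  where "form_orthogonal D q S = {w \<in> D. \<forall>s\<in>S. polarize q w s = 0}"

definition form_projection :: "('a::complex_inner_space \<Rightarrow> real) \<Rightarrow> 'a set \<Rightarrow> 'a \<Rightarrow> 'a"
  where "form_projection q S u = (THE w. w \<in> S \<and> (\<forall>s\<in>S. polarize q (u - w) s = 0))"

definition kerJ_projection ::
    "'a::complex_inner_space set \<Rightarrow> ('a \<Rightarrow> real) \<Rightarrow> 'a set \<Rightarrow> ('a \<Rightarrow> 'b::complex_inner_space)
      \<Rightarrow> real \<Rightarrow> 'a \<Rightarrow> 'a"
  where "kerJ_projection D E domJ J l =
    form_projection (form_shift E l)
      (form_orthogonal D (form_shift E l) {u \<in> domJ. J u = 0})"

text \<open>
  \<open>inv_into domJ J y\<close> picks some \<open>u \<in> domJ\<close> with \<open>J u = y\<close>; the projection of \<open>u\<close> depends on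
  \<open>J u\<close> only.
\<close>

definition trace_form ::
    "'a::complex_inner_space set \<Rightarrow> ('a \<Rightarrow> real) \<Rightarrow> 'a set \<Rightarrow> ('a \<Rightarrow> 'b::complex_inner_space)
      \<Rightarrow> real \<Rightarrow> 'b \<Rightarrow> real"
  where "trace_form D E domJ J l y =
    form_shift E l (kerJ_projection D E domJ J l (inv_into domJ J y))"

definition trace_operator ::
    "'a::complex_inner_space set \<Rightarrow> ('a \<Rightarrow> real) \<Rightarrow> 'a set \<Rightarrow> ('a \<Rightarrow> 'b::complex_inner_space)
      \<Rightarrow> real \<Rightarrow> ('b \<times> 'b) set"
  where "trace_operator D E domJ J l = form_operator (J ` domJ) (trace_form D E domJ J l)"

definition limit_trace_operator ::
    "'a::complex_inner_space set \<Rightarrow> ('a \<Rightarrow> real) \<Rightarrow> 'a set \<Rightarrow> ('a \<Rightarrow> 'b::complex_inner_space)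
      \<Rightarrow> ('b \<times> 'b) set"
  where "limit_trace_operator D E domJ J =
    (THE T. positive_self_adjoint T \<and>
      (\<forall>f. ((\<lambda>l. resolvent1 (trace_operator D E domJ J l) f) \<longlongrightarrow> resolvent1 T f) (at_right 0)))"

end

theory Submission
  imports Defs
begin

text \<open>
  Write \<open>\<E>\<^sub>l(u, v) = \<E>(u, v) + l (u, v)\<close> for \<open>l > 0\<close>. The resolvent of the trace operator has a
  description in which the projection onto the complement of \<open>ker J\<close> no longer occurs: its value
  at \<open>f\<close> is \<open>J u\<close>, where \<open>u = solution l f\<close> is the only element of \<open>dom J\<close> with
  \<open>\<E>\<^sub>l(u, v) + (J u, J v) = (f, J v)\<close> for all \<open>v \<in> dom J\<close> (lemma \<open>resolvent_trace_operator\<close>). Such a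
  \<open>u\<close> exists by Riesz's theorem, because closedness of \<open>\<E>\<close> and of \<open>J\<close> makes \<open>dom J\<close> complete; it
  is orthogonal to \<open>ker J\<close> with respect to \<open>\<E>\<^sub>l\<close>, hence fixed by the projection.

  The element \<open>u\<close> minimizes \<open>\<E>\<^sub>l[u] + |J u|\<^sup>2 - 2 Re (f, J u)\<close>, and the minimum is minus the energy
  \<open>e\<^sub>l = (f, J u)\<close>. The functional decreases with \<open>l\<close>, so \<open>e\<^sub>l\<close> increases as \<open>l\<close> decreases
  to \<open>0\<close>, and it is bounded by \<open>|f|\<^sup>2\<close>. The excess of the functional over its minimum controls the
  distance of the solutions: for \<open>m \<le> l\<close>,
  \<open>\<E>[u\<^sub>m - u\<^sub>l] + |J u\<^sub>m - J u\<^sub>l|\<^sup>2 \<le> e\<^sub>m - e\<^sub>l\<close> (lemma \<open>solution_difference\<close>). Hence \<open>J u\<^sub>l\<close>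
  converges in norm to some \<open>R f\<close>, and \<open>u\<^sub>l\<close> is Cauchy with respect to the seminorm of \<open>\<E>\<close>.

  Let \<open>A\<close> be the Arendt-ter Elst operator. Taking \<open>u\<^sub>l\<close> along \<open>l = 1 / (n + 1)\<close> as the required
  sequence gives \<open>(R f, f - R f) \<in> A\<close>. Conversely let \<open>(x, f) \<in> A\<close> be witnessed by \<open>(w\<^sub>n)\<close>, and let
  \<open>u\<^sub>l\<close> be the solutions for some \<open>g\<close>. As \<open>\<E>[w\<^sub>n]\<close> is bounded and \<open>u\<^sub>l\<close> is Cauchy, the limits
  \<open>n \<rightarrow> \<infinity>\<close> and \<open>l \<rightarrow> 0\<close> of \<open>\<E>(u\<^sub>l, w\<^sub>n)\<close> may be interchanged; comparing them yields
  \<open>(R g, f + x) = (g, x)\<close> (lemma \<open>A_imp_cinner_R\<close>). Applied to \<open>(R h, h - R h)\<close> this says that \<open>R\<close>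
  is symmetric, and then in general that \<open>x = R (f + x)\<close>. So \<open>A\<close> is exactly the graph of
  \<open>R\<^sup>-\<^sup>1 - 1\<close>.

  As \<open>R\<close> is symmetric, injective and everywhere defined, \<open>A\<close> is self-adjoint, and it is positive
  because \<open>|R f|\<^sup>2 \<le> (f, R f)\<close>. By construction \<open>R = (A + 1)\<^sup>-\<^sup>1\<close> is the strong limit of the
  resolvents. This proves the existence of the limit operator; any other candidate has the same
  resolvent, hence is contained in \<open>A\<close>, hence equals \<open>A\<close> by maximality of self-adjoint operators.
\<close>

section \<open>Complex inner products and subspaces\<close>

lemma scaleC_minus_one: "scaleC (-1) x = - (x::'a::complex_inner_space)"
  using scaleR_scaleC[of "-1" x] by simp

lemma csubspace_add: "csubspace S \<Longrightarrow> x \<in> S \<Longrightarrow> y \<in> S \<Longrightarrow> x + y \<in> S"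
  and csubspace_scaleC: "csubspace S \<Longrightarrow> x \<in> S \<Longrightarrow> scaleC c x \<in> S"
  and csubspace_zero: "csubspace S \<Longrightarrow> 0 \<in> S"
  by (auto simp: csubspace_def)

lemma csubspace_diff: "csubspace S \<Longrightarrow> x \<in> S \<Longrightarrow> y \<in> S \<Longrightarrow> x - y \<in> S"
  using csubspace_add[of S x "scaleC (-1) y"] csubspace_scaleC[of S y "-1"]
  by (simp add: scaleC_minus_one)

lemma csubspace_UNIV: "csubspace UNIV"
  by (simp add: csubspace_def)

lemma clinear_on_add: "clinear_on S f \<Longrightarrow> x \<in> S \<Longrightarrow> y \<in> S \<Longrightarrow> f (x + y) = f x + f y"
  and clinear_on_scaleC: "clinear_on S f \<Longrightarrow> x \<in> S \<Longrightarrow> f (scaleC c x) = scaleC c (f x)"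
  by (auto simp: clinear_on_def)

lemma clinear_on_diff:
  assumes "csubspace S" "clinear_on S f" "x \<in> S" "y \<in> S"
  shows "f (x - y) = f x - f y"
  using clinear_on_add[OF assms(2,3) csubspace_scaleC[OF assms(1,4), of "-1"]]
    clinear_on_scaleC[OF assms(2,4), of "-1"]
  by (simp add: scaleC_minus_one)

lemma csubspace_image:
  assumes "csubspace S" "clinear_on S f"
  shows "csubspace (f ` S)"
proof -
  have "0 \<in> f ` S"
    using clinear_on_diff[OF assms csubspace_zero[OF assms(1)] csubspace_zero[OF assms(1)]]
      csubspace_zero[OF assms(1)] by (auto intro!: image_eqI[of _ _ 0])
  moreover have "f x + f y \<in> f ` S" if "x \<in> S" "y \<in> S" for x y
    using clinear_on_add[OF assms(2) that, symmetric] csubspace_add[OF assms(1) that] by simp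
  moreover have "scaleC c (f x) \<in> f ` S" if "x \<in> S" for x c
    using clinear_on_scaleC[OF assms(2) that, symmetric] csubspace_scaleC[OF assms(1) that] by simp
  ultimately show ?thesis
    by (auto simp: csubspace_def)
qed

lemma csubspace_kernel:
  assumes "csubspace S" "clinear_on S f"
  shows "csubspace {u \<in> S. f u = 0}"
proof -
  have "f 0 = 0"
    using clinear_on_diff[OF assms csubspace_zero[OF assms(1)] csubspace_zero[OF assms(1)]] by simp
  moreover have "scaleC c (0::'b) = 0" for c
    using scaleC_add_right[of c 0 "0::'b"] by simp
  ultimately show ?thesis
    using assms by (auto simp: csubspace_def clinear_on_def)
qed

section \<open>Positive sesquilinear forms\<close>

text \<open>
  A quadratic polynomial in a complex variable that is nowhere negative has nonpositive
  discriminant. Both the Cauchy-Schwarz inequality and the estimate of the residual of a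
  minimizing sequence in Riesz's theorem are instances of this.
\<close>
lemma complex_discriminant:
  fixes c :: complex
  assumes nn: "\<And>s. 0 \<le> A + 2 * Re (cnj s * c) + (cmod s)\<^sup>2 * B" and "0 \<le> B"
  shows "(cmod c)\<^sup>2 \<le> A * B"
proof -
  have real_mult: "0 \<le> A - 2 * r * (cmod c)\<^sup>2 + r\<^sup>2 * (cmod c)\<^sup>2 * B" for r
  proof -
    have "Re (cnj (of_real (- r) * c) * c) = - r * (cmod c)\<^sup>2"
      unfolding cmod_power2 by (simp add: power2_eq_square algebra_simps)
    moreover have "(cmod (of_real (- r) * c))\<^sup>2 = r\<^sup>2 * (cmod c)\<^sup>2"
      by (simp add: norm_mult power_mult_distrib)
    ultimately show ?thesis
      using nn[of "of_real (- r) * c"] by (simp only:)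
  qed
  show ?thesis
  proof (cases "B = 0")
    case True
    have "c = 0"
    proof (rule ccontr)
      assume "c \<noteq> 0"
      then show False
        using real_mult[of "(A + 1) / (2 * (cmod c)\<^sup>2)"] True by (simp add: field_simps)
    qed
    then show ?thesis using True by simp
  next
    case False
    then have "B > 0" using assms(2) by simp
    then show ?thesis
      using real_mult[of "1 / B"] by (simp add: field_simps power2_eq_square)
  qed
qed

locale positive_sesquilinear =
  fixes V :: "'a::complex_inner_space set" and t :: "'a \<Rightarrow> 'a \<Rightarrow> complex" and q :: "'a \<Rightarrow> real"
  assumes subspace: "csubspace V" and sesquilinear: "sesquilinear_on V t"
    and diagonal: "u \<in> V \<Longrightarrow> t u u = complex_of_real (q u)" and nonneg: "u \<in> V \<Longrightarrow> 0 \<le> q u"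
begin

lemma closed_ops [simp, intro]:
  "u \<in> V \<Longrightarrow> v \<in> V \<Longrightarrow> u + v \<in> V" "u \<in> V \<Longrightarrow> v \<in> V \<Longrightarrow> u - v \<in> V"
  "u \<in> V \<Longrightarrow> scaleC c u \<in> V"
  using subspace by (auto intro: csubspace_add csubspace_diff csubspace_scaleC)

lemma add_left: "x \<in> V \<Longrightarrow> y \<in> V \<Longrightarrow> z \<in> V \<Longrightarrow> t (x + y) z = t x z + t y z"
  and add_right: "x \<in> V \<Longrightarrow> y \<in> V \<Longrightarrow> z \<in> V \<Longrightarrow> t z (x + y) = t z x + t z y"
  and scale_left: "x \<in> V \<Longrightarrow> y \<in> V \<Longrightarrow> t (scaleC c x) y = c * t x y"
  and scale_right: "x \<in> V \<Longrightarrow> y \<in> V \<Longrightarrow> t x (scaleC c y) = cnj c * t x y"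
  using sesquilinear by (auto simp: sesquilinear_on_def)

lemma diff_left: "x \<in> V \<Longrightarrow> y \<in> V \<Longrightarrow> z \<in> V \<Longrightarrow> t (x - y) z = t x z - t y z"
  using add_left[of x "scaleC (-1) y" z] scale_left[of y z "-1"] closed_ops(3)[of y "-1"]
  by (simp add: scaleC_minus_one)

lemma diff_right: "x \<in> V \<Longrightarrow> y \<in> V \<Longrightarrow> z \<in> V \<Longrightarrow> t z (x - y) = t z x - t z y"
  using add_right[of x "scaleC (-1) y" z] scale_right[of z y "-1"] closed_ops(3)[of y "-1"]
  by (simp add: scaleC_minus_one)

lemmas expand = add_left add_right scale_left scale_right diff_left diff_right

text \<open>The values of the form at \<open>u + v\<close> and \<open>u + \<i> v\<close> are real.\<close>
lemma hermitian:
  assumes "u \<in> V" "v \<in> V"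
  shows "t v u = cnj (t u v)"
proof -
  have "Im (t (u + v) (u + v)) = 0" "Im (t (u + scaleC \<i> v) (u + scaleC \<i> v)) = 0"
    "Im (t u u) = 0" "Im (t v v) = 0"
    using assms by (simp_all add: diagonal)
  then show ?thesis
    using assms by (simp add: expand complex_eq_iff)
qed

lemma q_add_scale:
  assumes "u \<in> V" "v \<in> V"
  shows "q (u + scaleC s v) = q u + 2 * Re (cnj s * t u v) + (cmod s)\<^sup>2 * q v"
proof -
  have "complex_of_real (q (u + scaleC s v)) = t (u + scaleC s v) (u + scaleC s v)"
    using assms by (simp add: diagonal)
  also have "\<dots> = t u u + cnj s * t u v + s * t v u + (s * cnj s) * t v v"
    using assms by (simp add: expand algebra_simps)
  finally have "q (u + scaleC s v)
      = Re (t u u + cnj s * t u v + s * cnj (t u v) + (s * cnj s) * t v v)"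
    using hermitian[OF assms] by (metis Re_complex_of_real)
  then show ?thesis
    using assms unfolding cmod_power2
    by (simp add: diagonal power2_eq_square algebra_simps)
qed

lemma q_diff:
  assumes "u \<in> V" "v \<in> V"
  shows "q (u - v) = q u - 2 * Re (t u v) + q v"
  using q_add_scale[OF assms, of "-1"] by (simp add: scaleC_minus_one)

lemma cauchy_schwarz:
  assumes "u \<in> V" "v \<in> V"
  shows "(cmod (t u v))\<^sup>2 \<le> q u * q v"
proof (rule complex_discriminant)
  show "0 \<le> q u + 2 * Re (cnj s * t u v) + (cmod s)\<^sup>2 * q v" for s
    using nonneg[of "u + scaleC s v"] assms by (simp add: q_add_scale)
qed (use assms nonneg in simp)

lemma polarize_eq:
  assumes "u \<in> V" "v \<in> V"
  shows "polarize q u v = t u v"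
proof -
  have "polarize q u v = (t (u + v) (u + v) - t (u - v) (u - v)
      + \<i> * t (u + scaleC \<i> v) (u + scaleC \<i> v) - \<i> * t (u - scaleC \<i> v) (u - scaleC \<i> v)) / 4"
    using assms by (simp add: polarize_def diagonal)
  then show ?thesis
    using assms by (simp add: expand algebra_simps)
qed

lemma polarized: "positive_sesquilinear V (polarize q) q"
proof
  show "sesquilinear_on V (polarize q)"
    by (simp add: sesquilinear_on_def polarize_eq expand)
qed (auto simp: subspace polarize_eq diagonal nonneg)

lemma zero_left: "v \<in> V \<Longrightarrow> t 0 v = 0"
  using csubspace_zero[OF subspace] diff_left[of 0 0 v] by simp

lemma restrict: "csubspace W \<Longrightarrow> W \<subseteq> V \<Longrightarrow> positive_sesquilinear W t q"
  using sesquilinear diagonal nonneg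
  by (auto simp: positive_sesquilinear_def sesquilinear_on_def subset_iff)

lemma pullback:
  assumes "csubspace W" "clinear_on W f" "f ` W \<subseteq> V"
  shows "positive_sesquilinear W (\<lambda>u v. t (f u) (f v)) (\<lambda>u. q (f u))"
proof
  show "sesquilinear_on W (\<lambda>u v. t (f u) (f v))"
    using assms(3) clinear_on_add[OF assms(2)] clinear_on_scaleC[OF assms(2)]
    by (auto simp: sesquilinear_on_def image_subset_iff expand)
qed (use assms in \<open>auto simp: diagonal nonneg image_subset_iff\<close>)

lemma scaled: "0 \<le> l \<Longrightarrow> positive_sesquilinear V (\<lambda>u v. complex_of_real l * t u v) (\<lambda>u. l * q u)"
  by unfold_locales
    (auto simp: subspace sesquilinear_on_def diagonal nonneg expand algebra_simps)

lemma sum: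
  assumes "positive_sesquilinear V t' q'"
  shows "positive_sesquilinear V (\<lambda>u v. t u v + t' u v) (\<lambda>u. q u + q' u)"
proof -
  interpret p: positive_sesquilinear V t' q' by fact
  show ?thesis
    by unfold_locales
      (auto simp: subspace sesquilinear_on_def diagonal nonneg expand
        p.diagonal p.nonneg p.expand algebra_simps)
qed

text \<open>
  Riesz representation without completeness: a minimizing sequence of
  \<open>u \<mapsto> q u - 2 Re (\<phi> u)\<close> represents the bounded antilinear functional \<open>\<phi>\<close> in the limit. If the
  functional exceeds its infimum by \<open>\<epsilon>\<close> at \<open>u\<close>, then varying \<open>u\<close> in direction \<open>v\<close> bounds the
  residual \<open>t u v - \<phi> v\<close> by \<open>sqrt (\<epsilon> * q v)\<close>. Applied to \<open>v = u m - u n\<close>, the same bound shows that the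
  sequence is Cauchy.
\<close>
lemma approximate_riesz:
  assumes add: "\<And>u v. u \<in> V \<Longrightarrow> v \<in> V \<Longrightarrow> \<phi> (u + v) = \<phi> u + \<phi> v"
    and scale: "\<And>c u. u \<in> V \<Longrightarrow> \<phi> (scaleC c u) = cnj c * \<phi> u"
    and bounded: "\<And>u. u \<in> V \<Longrightarrow> (cmod (\<phi> u))\<^sup>2 \<le> C * q u"
  obtains u :: "nat \<Rightarrow> 'a" where "\<And>n. u n \<in> V"
    and "\<And>e. 0 < e \<Longrightarrow> \<exists>N. \<forall>m\<ge>N. \<forall>n\<ge>N. sqrt (q (u m - u n)) < e"
    and "\<And>v. v \<in> V \<Longrightarrow> (\<lambda>n. t (u n) v) \<longlonglongrightarrow> \<phi> v"
proof -
  define F where "F u = q u - 2 * Re (\<phi> u)" for u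
  define m where "m = Inf (F ` V)"
  have "- \<bar>C\<bar> \<le> F u" if "u \<in> V" for u
  proof -
    have "(cmod (\<phi> u))\<^sup>2 \<le> \<bar>C\<bar> * q u"
      using bounded[OF that] nonneg[OF that] by (meson abs_ge_self mult_right_mono order_trans)
    then have "cmod (\<phi> u) \<le> sqrt (\<bar>C\<bar> * q u)"
      by (simp add: real_le_rsqrt)
    also have "\<dots> \<le> (\<bar>C\<bar> + q u) / 2"
      using arith_geo_mean_sqrt[of "\<bar>C\<bar>" "q u"] nonneg[OF that] by simp
    finally show ?thesis
      using complex_Re_le_cmod[of "\<phi> u"] by (simp add: F_def)
  qed
  then have bdd: "bdd_below (F ` V)" by (rule bdd_belowI2)
  have ne: "F ` V \<noteq> {}" using csubspace_zero[OF subspace] by auto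
  have m_le: "m \<le> F u" if "u \<in> V" for u
    unfolding m_def using bdd that by (auto intro: cInf_lower)
  have residual: "(cmod (t u v - \<phi> v))\<^sup>2 \<le> (F u - m) * q v" if "u \<in> V" "v \<in> V" for u v
  proof (rule complex_discriminant)
    show "0 \<le> F u - m + 2 * Re (cnj s * (t u v - \<phi> v)) + (cmod s)\<^sup>2 * q v" for s
      using m_le[of "u + scaleC s v"] that
      by (simp add: F_def q_add_scale add scale algebra_simps)
  qed (use that nonneg in simp)
  have "\<exists>u\<in>V. F u < m + inverse (real (Suc n))" for n
    using cInf_less_iff[OF ne bdd, of "m + inverse (real (Suc n))"] by (auto simp: m_def)
  then obtain u where u: "\<And>n. u n \<in> V" and Fu: "\<And>n. F (u n) < m + inverse (real (Suc n))"
    by metis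
  define r where "r n = sqrt (inverse (real (Suc n)))" for n
  have r0: "r \<longlonglongrightarrow> 0"
    unfolding r_def using tendsto_real_sqrt[OF LIMSEQ_inverse_real_of_nat] by simp
  have res: "cmod (t (u n) v - \<phi> v) \<le> r n * sqrt (q v)" if "v \<in> V" for n v
  proof -
    have "(cmod (t (u n) v - \<phi> v))\<^sup>2 \<le> inverse (real (Suc n)) * q v"
      using residual[OF u[of n] that] mult_right_mono[OF less_imp_le[of "F (u n) - m"] nonneg[OF that]]
        Fu[of n] by (smt (verit, best))
    then show ?thesis
      unfolding r_def by (metis real_le_rsqrt real_sqrt_mult)
  qed
  have cauchy: "sqrt (q (u m - u n)) \<le> r m + r n" for m n
  proof (cases "q (u m - u n) = 0")
    case True
    then show ?thesis by (simp add: r_def)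
  next
    case False
    let ?v = "u m - u n"
    have v: "?v \<in> V" using u by simp
    have pos: "0 < q ?v" using False nonneg[OF v] by simp
    have "complex_of_real (q ?v) = (t (u m) ?v - \<phi> ?v) - (t (u n) ?v - \<phi> ?v)"
      using diagonal[OF v] diff_left[OF u u v] by simp
    then have "q ?v \<le> cmod (t (u m) ?v - \<phi> ?v) + cmod (t (u n) ?v - \<phi> ?v)"
      by (metis abs_of_pos norm_of_real norm_triangle_ineq4 pos)
    then have "q ?v \<le> (r m + r n) * sqrt (q ?v)"
      using res[OF v, of m] res[OF v, of n] by (simp add: algebra_simps)
    then have "sqrt (q ?v) * sqrt (q ?v) \<le> (r m + r n) * sqrt (q ?v)"
      using pos by simp
    then show ?thesis
      by (rule mult_right_le_imp_le) (use pos in simp)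
  qed
  have "\<exists>N. \<forall>m\<ge>N. \<forall>n\<ge>N. sqrt (q (u m - u n)) < e" if "0 < e" for e
  proof -
    have "eventually (\<lambda>n. r n < e / 2) sequentially"
      using order_tendstoD(2)[OF r0, of "e / 2"] that by simp
    then obtain N where "\<And>n. n \<ge> N \<Longrightarrow> r n < e / 2" by (auto simp: eventually_sequentially)
    then have "\<forall>m\<ge>N. \<forall>n\<ge>N. sqrt (q (u m - u n)) < e"
      using cauchy by (smt (verit, best) field_sum_of_halves)
    then show ?thesis by blast
  qed
  moreover have "(\<lambda>n. t (u n) v) \<longlonglongrightarrow> \<phi> v" if "v \<in> V" for v
  proof (rule LIM_zero_cancel, rule Lim_null_comparison)
    show "eventually (\<lambda>n. cmod (t (u n) v - \<phi> v) \<le> r n * sqrt (q v)) sequentially"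
      using res[OF that] by simp
    show "(\<lambda>n. r n * sqrt (q v)) \<longlonglongrightarrow> 0"
      using tendsto_mult_right[OF r0, of "sqrt (q v)"] by simp
  qed
  ultimately show ?thesis using that u by blast
qed

lemma tendsto_left:
  assumes "\<And>n. u n \<in> V" "w \<in> V" "v \<in> V" and "(\<lambda>n. sqrt (q (u n - w))) \<longlonglongrightarrow> 0"
  shows "(\<lambda>n. t (u n) v) \<longlonglongrightarrow> t w v"
proof (rule LIM_zero_cancel, rule Lim_null_comparison)
  have "cmod (t (u n) v - t w v) \<le> sqrt (q (u n - w)) * sqrt (q v)" for n
    using cauchy_schwarz[of "u n - w" v] assms
    by (simp add: diff_left real_le_rsqrt flip: real_sqrt_mult)
  then show "eventually (\<lambda>n. cmod (t (u n) v - t w v) \<le> sqrt (q (u n - w)) * sqrt (q v)) sequentially"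
    by simp
  show "(\<lambda>n. sqrt (q (u n - w)) * sqrt (q v)) \<longlonglongrightarrow> 0"
    using tendsto_mult_right[OF assms(4), of "sqrt (q v)"] by simp
qed

lemma riesz:
  assumes complete: "\<And>u::nat \<Rightarrow> 'a. (\<And>n. u n \<in> V) \<Longrightarrow>
      (\<And>e. 0 < e \<Longrightarrow> \<exists>N. \<forall>m\<ge>N. \<forall>n\<ge>N. sqrt (q (u m - u n)) < e) \<Longrightarrow>
      \<exists>w\<in>V. (\<lambda>n. sqrt (q (u n - w))) \<longlonglongrightarrow> 0"
    and "\<And>u v. u \<in> V \<Longrightarrow> v \<in> V \<Longrightarrow> \<phi> (u + v) = \<phi> u + \<phi> v"
    and "\<And>c u. u \<in> V \<Longrightarrow> \<phi> (scaleC c u) = cnj c * \<phi> u"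
    and "\<And>u. u \<in> V \<Longrightarrow> (cmod (\<phi> u))\<^sup>2 \<le> C * q u"
  shows "\<exists>w\<in>V. \<forall>v\<in>V. t w v = \<phi> v"
proof -
  obtain u where u: "\<And>n. u n \<in> V"
    "\<And>e. 0 < e \<Longrightarrow> \<exists>N. \<forall>m\<ge>N. \<forall>n\<ge>N. sqrt (q (u m - u n)) < e"
    and lim: "\<And>v. v \<in> V \<Longrightarrow> (\<lambda>n. t (u n) v) \<longlonglongrightarrow> \<phi> v"
    using approximate_riesz[of \<phi> C] assms(2-4) by blast
  obtain w where w: "w \<in> V" "(\<lambda>n. sqrt (q (u n - w))) \<longlonglongrightarrow> 0"
    using complete[OF u] by blast
  then show ?thesis
    using tendsto_left[OF u(1) w(1) _ w(2)] lim by (blast intro: LIMSEQ_unique)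
qed

end

interpretation cinner: positive_sesquilinear UNIV cinner
    "\<lambda>x::'a::complex_inner_space. (norm x)\<^sup>2"
proof
  have "cinner z (x + y) = cinner z x + cinner z y" for x y z :: 'a
    using cinner_commute[of z "x + y"] cinner_commute[of z x] cinner_commute[of z y]
    by (simp add: cinner_add_left)
  moreover have "cinner x (scaleC c y) = cnj c * cinner x y" for x y :: 'a and c
    using cinner_commute[of x "scaleC c y"] cinner_commute[of x y] by (simp add: cinner_scaleC_left)
  ultimately show "sesquilinear_on UNIV (cinner :: 'a \<Rightarrow> 'a \<Rightarrow> complex)"
    by (simp add: sesquilinear_on_def cinner_add_left cinner_scaleC_left)
qed (auto simp: csubspace_UNIV cinner_norm)

lemma cmod_cinner_le: "cmod (cinner x y) \<le> norm x * norm y"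
  using cinner.cauchy_schwarz[of x y] by (simp flip: power_mult_distrib)

lemma bounded_linear_cinner_left: "bounded_linear (\<lambda>x. cinner x y)"
proof (rule bounded_linear_intro[where K = "norm y"])
  show "cinner (scaleR r x) y = scaleR r (cinner x y)" for r x
    by (simp add: scaleR_scaleC cinner_scaleC_left scaleC_complex_def)
qed (auto simp: cinner_add_left cmod_cinner_le)

lemma tendsto_cinner:
  assumes "(f \<longlongrightarrow> a) F" "(g \<longlongrightarrow> b) F"
  shows "((\<lambda>x. cinner (f x) (g x)) \<longlongrightarrow> cinner a b) F"
proof -
  have 1: "((\<lambda>x. cinner (f x) b) \<longlongrightarrow> cinner a b) F"
    by (rule bounded_linear.tendsto[OF bounded_linear_cinner_left assms(1)])
  have "((\<lambda>x. norm (f x) * norm (g x - b)) \<longlongrightarrow> norm a * 0) F"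
    by (rule tendsto_mult[OF tendsto_norm[OF assms(1)] tendsto_norm_zero[OF LIM_zero[OF assms(2)]]])
  then have "((\<lambda>x. norm (f x) * norm (g x - b)) \<longlongrightarrow> 0) F"
    by simp
  then have 2: "((\<lambda>x. cinner (f x) (g x - b)) \<longlongrightarrow> 0) F"
    by (rule Lim_null_comparison[OF always_eventually[OF allI[OF cmod_cinner_le]]])
  show ?thesis
    using tendsto_add[OF 1 2] by (simp add: cinner.diff_right)
qed

lemma cinner_eqI:
  assumes "\<And>z. cinner z x = cinner z y"
  shows "x = y"
  using assms[of "x - y"] cinner_norm[of "x - y"] by (simp add: cinner.diff_right)

lemma dense_orthogonal_zero:
  assumes "closure S = UNIV" "\<And>s. s \<in> S \<Longrightarrow> cinner x s = 0"
  shows "x = 0"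
proof -
  obtain s where s: "\<And>n. s n \<in> S" "s \<longlonglongrightarrow> x"
    using assms(1) closure_sequential[of x S] by auto
  have "(\<lambda>n. cinner x (s n)) \<longlonglongrightarrow> cinner x x"
    by (rule tendsto_cinner) (use s in simp_all)
  then have "cinner x x = 0"
    using assms(2) s(1) by (simp add: LIMSEQ_const_iff)
  then show ?thesis by (simp add: cinner_norm)
qed

text \<open>
  Every \<open>y\<close> has an orthogonal projection onto the closure of \<open>S\<close>, obtained as the limit of an
  approximating sequence in \<open>S\<close>. The difference is orthogonal to \<open>S\<close>, hence zero.
\<close>
lemma closure_eq_UNIV_if_orthogonal_zero:
  fixes S :: "'a::complex_hilbert_space set"
  assumes "csubspace S" and zero: "\<And>x. (\<And>s. s \<in> S \<Longrightarrow> cinner x s = 0) \<Longrightarrow> x = 0"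
  shows "closure S = UNIV"
proof -
  interpret S: positive_sesquilinear S cinner "\<lambda>x. (norm x)\<^sup>2"
    by (rule cinner.restrict[OF assms(1) subset_UNIV])
  have "y \<in> closure S" for y
  proof -
    obtain u where u: "\<And>n. u n \<in> S"
      and cauchy: "\<And>e. 0 < e \<Longrightarrow> \<exists>N. \<forall>m\<ge>N. \<forall>n\<ge>N. sqrt ((norm (u m - u n))\<^sup>2) < e"
      and lim: "\<And>v. v \<in> S \<Longrightarrow> (\<lambda>n. cinner (u n) v) \<longlonglongrightarrow> cinner y v"
    proof (rule S.approximate_riesz[of "cinner y" "(norm y)\<^sup>2"])
      show "(cmod (cinner y u))\<^sup>2 \<le> (norm y)\<^sup>2 * (norm u)\<^sup>2" for u
        by (rule cinner.cauchy_schwarz) simp_all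
    next
      fix u :: "nat \<Rightarrow> 'a"
      assume "\<And>n. u n \<in> S"
        "\<And>e. 0 < e \<Longrightarrow> \<exists>N. \<forall>m\<ge>N. \<forall>n\<ge>N. sqrt ((norm (u m - u n))\<^sup>2) < e"
        "\<And>v. v \<in> S \<Longrightarrow> (\<lambda>n. cinner (u n) v) \<longlonglongrightarrow> cinner y v"
      then show thesis by (rule that)
    qed (simp_all add: cinner.add_right cinner.scale_right)
    have "Cauchy u"
      using cauchy by (auto simp: Cauchy_def dist_norm)
    then obtain w where w: "u \<longlonglongrightarrow> w"
      by (auto simp: Cauchy_convergent_iff convergent_def)
    have "cinner (y - w) s = 0" if "s \<in> S" for s
      using LIMSEQ_unique[OF lim[OF that] tendsto_cinner[OF w tendsto_const]]
      by (simp add: cinner.diff_left)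
    then have "y = w" using zero[of "y - w"] by auto
    then show ?thesis using u w closure_sequential by blast
  qed
  then show ?thesis by auto
qed

section \<open>Self-adjoint operators\<close>

text \<open>Taking adjoints reverses inclusions.\<close>
lemma self_adjoint_maximal:
  assumes "self_adjoint T" "self_adjoint A" "T \<subseteq> A"
  shows "T = A"
proof -
  have "adjoint_graph A \<subseteq> adjoint_graph T"
    using assms(3) by (auto simp: adjoint_graph_def)
  then show ?thesis
    using assms by (auto simp: self_adjoint_def)
qed

lemma self_adjoint_diff:
  assumes "self_adjoint T" "(x, f) \<in> T" "(y, g) \<in> T"
  shows "(x - y, f - g) \<in> T"
proof -
  have T: "adjoint_graph T = T"
    using assms(1) by (simp add: self_adjoint_def)
  then have "(x, f) \<in> adjoint_graph T" "(y, g) \<in> adjoint_graph T"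
    using assms by simp_all
  then have "(x - y, f - g) \<in> adjoint_graph T"
    by (fastforce simp: adjoint_graph_def cinner.diff_right)
  then show ?thesis
    by (simp add: T)
qed

text \<open>
  The difference \<open>d\<close> of two solutions satisfies \<open>(d, - d) \<in> T\<close>, so positivity of \<open>T\<close> forces \<open>d = 0\<close>.
\<close>
lemma resolvent1_eqI:
  assumes T: "positive_self_adjoint T" and x: "(x, f - x) \<in> T"
  shows "resolvent1 T f = x"
  unfolding resolvent1_def
proof (rule the_equality)
  fix y assume "(y, f - y) \<in> T"
  then have "(y - x, x - y) \<in> T"
    using self_adjoint_diff[of T y "f - y" x "f - x"] T x by (simp add: positive_self_adjoint_def)
  then have "0 \<le> Re (cinner (x - y) (y - x))"
    using T by (auto simp: positive_self_adjoint_def)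
  moreover have "cinner (x - y) (y - x) = - cinner (y - x) (y - x)"
    by (simp add: cinner.diff_left cinner.diff_right)
  ultimately show "y = x"
    by (simp add: cinner_norm)
qed (rule x)

section \<open>The trace forms and their resolvents\<close>

locale trace_setting =
  fixes D :: "'h::complex_hilbert_space set"
    and E :: "'h \<Rightarrow> real"
    and domJ :: "'h set"
    and J :: "'h \<Rightarrow> 'k::complex_hilbert_space"
  assumes positive: "positive_form D E"
    and closed: "closed_form D E"
    and subspace: "csubspace domJ"
    and domJ_D: "domJ \<subseteq> D"
    and linear: "clinear_on domJ J"
    and dense: "closure (J ` domJ) = UNIV"
    and J_closed: "form_closed_operator D E domJ J"
begin

definition shifted :: "real \<Rightarrow> 'h \<Rightarrow> 'h \<Rightarrow> complex"
  where "shifted l u v = polarize E u v + complex_of_real l * cinner u v"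

definition penalized :: "real \<Rightarrow> 'h \<Rightarrow> 'h \<Rightarrow> complex"
  where "penalized l u v = shifted l u v + cinner (J u) (J v)"

definition penalty :: "real \<Rightarrow> 'h \<Rightarrow> real"
  where "penalty l u = form_shift E l u + (norm (J u))\<^sup>2"

definition kerJ :: "'h set"
  where "kerJ = {u \<in> domJ. J u = 0}"

lemma form: "positive_sesquilinear D (polarize E) E"
proof -
  obtain t where "positive_sesquilinear D t E"
    using positive by (auto simp: positive_form_def positive_sesquilinear_def)
  then show ?thesis
    by (rule positive_sesquilinear.polarized)
qed

lemma shifted_form:
  assumes "0 \<le> l"
  shows "positive_sesquilinear D (shifted l) (form_shift E l)"
proof -
  have "csubspace D" using positive by (simp add: positive_form_def)
  then have "positive_sesquilinear D cinner (\<lambda>u. (norm u)\<^sup>2)"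
    by (rule cinner.restrict) simp
  from positive_sesquilinear.sum[OF form positive_sesquilinear.scaled[OF this assms]]
  show ?thesis
    by (simp add: shifted_def[abs_def] form_shift_def[abs_def])
qed

lemma penalized_form:
  assumes "0 \<le> l"
  shows "positive_sesquilinear domJ (penalized l) (penalty l)"
proof -
  have "positive_sesquilinear domJ (\<lambda>u v. cinner (J u) (J v)) (\<lambda>u. (norm (J u))\<^sup>2)"
    by (rule cinner.pullback[OF subspace linear]) simp
  from positive_sesquilinear.sum[OF
      positive_sesquilinear.restrict[OF shifted_form[OF assms] subspace domJ_D] this]
  show ?thesis
    by (simp add: penalized_def[abs_def] penalty_def[abs_def])
qed

lemma form_domJ: "positive_sesquilinear domJ (polarize E) E"
  by (rule positive_sesquilinear.restrict[OF form subspace domJ_D])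

lemma E_nonneg: "u \<in> D \<Longrightarrow> 0 \<le> E u"
  by (rule positive_sesquilinear.nonneg[OF form])

lemma subspace_D: "csubspace D"
  using positive by (simp add: positive_form_def)

lemma subspace_kerJ: "csubspace kerJ"
  unfolding kerJ_def by (rule csubspace_kernel[OF subspace linear])

lemma kerJ_domJ: "kerJ \<subseteq> domJ"
  by (auto simp: kerJ_def)

lemma J_diff: "u \<in> domJ \<Longrightarrow> v \<in> domJ \<Longrightarrow> J (u - v) = J u - J v"
  by (rule clinear_on_diff[OF subspace linear])

text \<open>
  All shifts by a positive parameter give equivalent norms on \<open>D\<close>; therefore completeness, which
  is assumed for the shift by \<open>1\<close>, holds for every positive shift.
\<close>
lemma form_shift_compare:
  assumes "0 < l" "0 \<le> m" "u \<in> D"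
  shows "form_shift E m u \<le> (1 + m / l) * form_shift E l u"
proof -
  have "0 \<le> m / l * E u" "0 \<le> l * (norm u)\<^sup>2"
    using assms E_nonneg[of u] by simp_all
  moreover have "(1 + m / l) * form_shift E l u
      = E u + l * (norm u)\<^sup>2 + m / l * E u + m * (norm u)\<^sup>2"
    using assms by (simp add: form_shift_def field_simps)
  ultimately show ?thesis
    by (simp add: form_shift_def)
qed

lemma form_shift_limit:
  assumes "0 < l" "0 \<le> m" and "\<And>n. u n \<in> D"
    and lim: "(\<lambda>n. sqrt (form_shift E l (u n))) \<longlonglongrightarrow> 0"
  shows "(\<lambda>n. sqrt (form_shift E m (u n))) \<longlonglongrightarrow> 0"
proof (rule tendsto_sandwich)
  show "\<forall>\<^sub>F n in sequentially. 0 \<le> sqrt (form_shift E m (u n))"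
    using positive_sesquilinear.nonneg[OF shifted_form[OF assms(2)]] assms(3) by simp
  show "\<forall>\<^sub>F n in sequentially.
      sqrt (form_shift E m (u n)) \<le> sqrt (1 + m / l) * sqrt (form_shift E l (u n))"
    using form_shift_compare[OF assms(1,2,3)] by (simp flip: real_sqrt_mult)
  show "(\<lambda>n. sqrt (1 + m / l) * sqrt (form_shift E l (u n))) \<longlonglongrightarrow> 0"
    using tendsto_mult_left[OF lim, of "sqrt (1 + m / l)"] by simp
qed simp

lemma complete_shifted:
  assumes "0 < l" and u: "\<And>n. u n \<in> D"
    and cauchy: "\<And>e. 0 < e \<Longrightarrow> \<exists>N. \<forall>m\<ge>N. \<forall>n\<ge>N. sqrt (form_shift E l (u m - u n)) < e"
  obtains w where "w \<in> D" and "\<And>m. 0 \<le> m \<Longrightarrow> (\<lambda>n. sqrt (form_shift E m (u n - w))) \<longlonglongrightarrow> 0"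
proof -
  define K where "K = sqrt (1 + 1 / l)"
  have K: "0 < K" using assms(1) by (simp add: K_def add_pos_pos)
  have diff: "u m - u n \<in> D" for m n
    using u by (intro csubspace_diff[OF subspace_D])
  have "\<exists>N. \<forall>m\<ge>N. \<forall>n\<ge>N. sqrt (form_shift E 1 (u m - u n)) < e" if "0 < e" for e
  proof -
    have "0 < e / K" using that K by simp
    from cauchy[OF this] obtain N
      where N: "\<And>m n. m \<ge> N \<Longrightarrow> n \<ge> N \<Longrightarrow> sqrt (form_shift E l (u m - u n)) < e / K"
      by blast
    have "sqrt (form_shift E 1 (u m - u n)) < e" if "m \<ge> N" "n \<ge> N" for m n
    proof -
      have "sqrt (form_shift E 1 (u m - u n)) \<le> K * sqrt (form_shift E l (u m - u n))"
        unfolding K_def using form_shift_compare[OF assms(1) _ diff, of 1 m n]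
        by (simp flip: real_sqrt_mult)
      also have "\<dots> < e"
        using N[OF that] K by (simp add: field_simps)
      finally show ?thesis .
    qed
    then show ?thesis by blast
  qed
  then obtain w where w: "w \<in> D" "(\<lambda>n. sqrt (form_shift E 1 (u n - w))) \<longlonglongrightarrow> 0"
    using closed u unfolding closed_form_def by blast
  show ?thesis
  proof (rule that[OF w(1)])
    show "(\<lambda>n. sqrt (form_shift E m (u n - w))) \<longlonglongrightarrow> 0" if "0 \<le> m" for m
      by (rule form_shift_limit[OF zero_less_one that _ w(2)])
        (intro csubspace_diff[OF subspace_D] u w(1))
  qed
qed

lemma closed_limit:
  assumes "\<And>n. u n \<in> domJ" "w \<in> D" "(\<lambda>n. sqrt (form_shift E 1 (u n - w))) \<longlonglongrightarrow> 0"
    "(\<lambda>n. J (u n)) \<longlonglongrightarrow> y"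
  shows "w \<in> domJ" "J w = y"
  using J_closed assms unfolding form_closed_operator_def by blast+

text \<open>
  The kernel of \<open>J\<close> is complete with respect to the shifted form since \<open>J\<close> is closed. Riesz's theorem
  applied on the kernel thus yields the orthogonal projection onto it, and its complementary
  projection is the one in the definition of the trace form.
\<close>
lemma kernel_component:
  assumes "0 < l" "u \<in> D"
  shows "\<exists>w\<in>kerJ. \<forall>v\<in>kerJ. shifted l (u - w) v = 0"
proof -
  interpret D: positive_sesquilinear D "shifted l" "form_shift E l"
    by (rule shifted_form) (use assms in simp)
  have sub: "kerJ \<subseteq> D" using kerJ_domJ domJ_D by blast
  interpret N: positive_sesquilinear kerJ "shifted l" "form_shift E l"
    by (rule D.restrict[OF subspace_kerJ sub])
  have "\<exists>w\<in>kerJ. \<forall>v\<in>kerJ. shifted l w v = shifted l u v"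
  proof (rule N.riesz)
    fix s :: "nat \<Rightarrow> 'h"
    assume s: "\<And>n. s n \<in> kerJ"
      and cauchy: "\<And>e. 0 < e \<Longrightarrow> \<exists>N. \<forall>m\<ge>N. \<forall>n\<ge>N. sqrt (form_shift E l (s m - s n)) < e"
    have sD: "s n \<in> D" for n using s sub by blast
    obtain w where w: "w \<in> D"
      and lim: "\<And>m. 0 \<le> m \<Longrightarrow> (\<lambda>n. sqrt (form_shift E m (s n - w))) \<longlonglongrightarrow> 0"
      using complete_shifted[OF assms(1) sD cauchy] by blast
    have "(\<lambda>n. J (s n)) \<longlonglongrightarrow> 0" using s by (simp add: kerJ_def)
    then have "w \<in> kerJ"
      using closed_limit[of s w 0] s w lim[of 1] by (auto simp: kerJ_def)
    then show "\<exists>w\<in>kerJ. (\<lambda>n. sqrt (form_shift E l (s n - w))) \<longlonglongrightarrow> 0"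
      using lim[of l] assms(1) by auto
  next
    fix v assume "v \<in> kerJ"
    then show "(cmod (shifted l u v))\<^sup>2 \<le> form_shift E l u * form_shift E l v"
      using D.cauchy_schwarz[OF assms(2)] sub by blast
  qed (use assms(2) sub in \<open>auto simp: D.expand subset_iff\<close>)
  then obtain w where w: "w \<in> kerJ" "\<And>v. v \<in> kerJ \<Longrightarrow> shifted l w v = shifted l u v"
    by blast
  have "shifted l (u - w) v = 0" if "v \<in> kerJ" for v
    using w that assms(2) sub by (simp add: D.diff_left subset_iff)
  then show ?thesis
    using w(1) by blast
qed

text \<open>
  The quadratic form \<open>penalty l\<close> is the square of a graph norm of \<open>J\<close>, so closedness of \<open>J\<close> is exactly what
  makes \<open>domJ\<close> complete for it.
\<close>
lemma solution_exists:
  assumes "0 < l"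
  shows "\<exists>u\<in>domJ. \<forall>v\<in>domJ. penalized l u v = cinner f (J v)"
proof -
  interpret P: positive_sesquilinear domJ "penalized l" "penalty l"
    by (rule penalized_form) (use assms in simp)
  interpret D: positive_sesquilinear D "shifted l" "form_shift E l"
    by (rule shifted_form) (use assms in simp)
  show ?thesis
  proof (rule P.riesz)
    fix u :: "nat \<Rightarrow> 'h"
    assume u: "\<And>n. u n \<in> domJ"
      and cauchy: "\<And>e. 0 < e \<Longrightarrow> \<exists>N. \<forall>m\<ge>N. \<forall>n\<ge>N. sqrt (penalty l (u m - u n)) < e"
    have uD: "u n \<in> D" for n using u domJ_D by blast
    have shift_le: "form_shift E l (u m - u n) \<le> penalty l (u m - u n)" for m n
      by (simp add: penalty_def)
    have J_le: "dist (J (u m)) (J (u n)) \<le> sqrt (penalty l (u m - u n))" for m n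
      using D.nonneg[of "u m - u n"] uD u by (simp add: penalty_def dist_norm J_diff real_le_rsqrt)
    have shift_cauchy: "\<exists>N. \<forall>m\<ge>N. \<forall>n\<ge>N. sqrt (form_shift E l (u m - u n)) < e" if "0 < e" for e
      using cauchy[OF that] shift_le by (meson order_le_less_trans real_sqrt_le_mono)
    obtain w where w: "w \<in> D"
      and lim: "\<And>m. 0 \<le> m \<Longrightarrow> (\<lambda>n. sqrt (form_shift E m (u n - w))) \<longlonglongrightarrow> 0"
      using complete_shifted[OF assms uD shift_cauchy] by blast
    have "Cauchy (\<lambda>n. J (u n))"
      unfolding Cauchy_def using cauchy J_le by (meson order_le_less_trans)
    then obtain y where y: "(\<lambda>n. J (u n)) \<longlonglongrightarrow> y"
      by (auto simp: Cauchy_convergent_iff convergent_def)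
    have w': "w \<in> domJ" "J w = y"
      using closed_limit[OF u w lim y] by simp_all
    have "(\<lambda>n. (sqrt (form_shift E l (u n - w)))\<^sup>2 + (norm (J (u n) - y))\<^sup>2) \<longlonglongrightarrow> 0\<^sup>2 + 0\<^sup>2"
      using assms by (intro tendsto_add tendsto_power lim tendsto_norm_zero LIM_zero[OF y]) simp
    then have "(\<lambda>n. penalty l (u n - w)) \<longlonglongrightarrow> 0"
      using D.nonneg uD w u w' by (simp add: penalty_def J_diff)
    then have "(\<lambda>n. sqrt (penalty l (u n - w))) \<longlonglongrightarrow> 0"
      using tendsto_real_sqrt by fastforce
    then show "\<exists>w\<in>domJ. (\<lambda>n. sqrt (penalty l (u n - w))) \<longlonglongrightarrow> 0"
      using w' by blast
  next
    fix u assume u: "u \<in> domJ"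
    have "(cmod (cinner f (J u)))\<^sup>2 \<le> (norm f)\<^sup>2 * (norm (J u))\<^sup>2"
      by (rule cinner.cauchy_schwarz) simp_all
    also have "\<dots> \<le> (norm f)\<^sup>2 * penalty l u"
      using D.nonneg[of u] u domJ_D by (intro mult_left_mono) (auto simp: penalty_def)
    finally show "(cmod (cinner f (J u)))\<^sup>2 \<le> (norm f)\<^sup>2 * penalty l u" .
  qed (simp_all add: clinear_on_add[OF linear] clinear_on_scaleC[OF linear] cinner.expand)
qed

definition solution :: "real \<Rightarrow> 'k \<Rightarrow> 'h"
  where "solution l f = (SOME u. u \<in> domJ \<and> (\<forall>v\<in>domJ. penalized l u v = cinner f (J v)))"

lemma solution:
  assumes "0 < l"
  shows solution_domJ: "solution l f \<in> domJ"
    and penalized_solution: "\<And>v. v \<in> domJ \<Longrightarrow> penalized l (solution l f) v = cinner f (J v)"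
proof -
  have "\<exists>u. u \<in> domJ \<and> (\<forall>v\<in>domJ. penalized l u v = cinner f (J v))"
    using solution_exists[OF assms] by blast
  from someI_ex[OF this]
  show "solution l f \<in> domJ"
    "\<And>v. v \<in> domJ \<Longrightarrow> penalized l (solution l f) v = cinner f (J v)"
    by (simp_all add: solution_def)
qed

lemma shifted_definite:
  assumes "0 < l" "u \<in> D" "shifted l u u = 0"
  shows "u = 0"
proof -
  have "form_shift E l u = 0"
    using positive_sesquilinear.diagonal[OF shifted_form, of l u] assms by simp
  then have "l * (norm u)\<^sup>2 = 0"
    using E_nonneg[OF assms(2)] assms(1)
    by (simp add: form_shift_def add_nonneg_eq_0_iff)
  then show ?thesis using assms(1) by simp
qed

lemma penalized_definite:
  assumes "0 < l" "u \<in> domJ" "penalized l u u = 0"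
  shows "u = 0"
proof -
  have u: "u \<in> D" using assms(2) domJ_D by blast
  have "complex_of_real (form_shift E l u + (norm (J u))\<^sup>2) = 0"
    using positive_sesquilinear.diagonal[OF penalized_form, of l u] assms
    by (simp add: penalty_def)
  then have "form_shift E l u + (norm (J u))\<^sup>2 = 0"
    using of_real_eq_0_iff by blast
  then have "form_shift E l u = 0"
    using positive_sesquilinear.nonneg[OF shifted_form, of l u] u assms(1)
    by (simp add: add_nonneg_eq_0_iff)
  then show ?thesis
    using shifted_definite[OF assms(1) u] u assms(1)
      positive_sesquilinear.diagonal[OF shifted_form, of l u] by simp
qed

lemma solution_unique:
  assumes "0 < l" "u \<in> domJ" "\<And>v. v \<in> domJ \<Longrightarrow> penalized l u v = cinner f (J v)"
  shows "u = solution l f"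
proof -
  interpret P: positive_sesquilinear domJ "penalized l" "penalty l"
    by (rule penalized_form) (use assms in simp)
  have "u - solution l f \<in> domJ"
    using assms solution_domJ by simp
  then have "u - solution l f = 0"
    using assms solution[OF assms(1)]
    by (intro penalized_definite[of l]) (simp_all add: P.diff_left)
  then show ?thesis by simp
qed

lemma kerJ_projection_eq:
  assumes l: "0 < l" and u: "u \<in> D" and w: "w \<in> kerJ"
    and orth: "\<And>v. v \<in> kerJ \<Longrightarrow> shifted l (u - w) v = 0"
  shows "kerJ_projection D E domJ J l u = u - w"
proof -
  interpret D: positive_sesquilinear D "shifted l" "form_shift E l"
    by (rule shifted_form) (use l in simp)
  have ND: "kerJ \<subseteq> D" using kerJ_domJ domJ_D by blast
  define S where "S = form_orthogonal D (form_shift E l) kerJ"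
  have S: "S = {x \<in> D. \<forall>s\<in>kerJ. shifted l x s = 0}"
    using ND by (auto simp: S_def form_orthogonal_def D.polarize_eq subset_iff)
  have wD: "w \<in> D" using w ND by blast
  have inS: "u - w \<in> S"
    using u wD orth by (simp add: S)
  have "(THE p. p \<in> S \<and> (\<forall>s\<in>S. polarize (form_shift E l) (u - p) s = 0)) = u - w"
  proof (rule the_equality)
    have "polarize (form_shift E l) w s = 0" if "s \<in> S" for s
      using that w wD D.hermitian[of s w] by (simp add: S D.polarize_eq)
    then show "u - w \<in> S \<and> (\<forall>s\<in>S. polarize (form_shift E l) (u - (u - w)) s = 0)"
      using inS by simp
  next
    fix p assume p: "p \<in> S \<and> (\<forall>s\<in>S. polarize (form_shift E l) (u - p) s = 0)"
    let ?d = "u - w - p"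
    have pD: "p \<in> D" using p by (simp add: S)
    have d: "?d \<in> S"
      using p inS pD u wD ND by (simp add: S D.diff_left subset_iff)
    have "polarize (form_shift E l) (u - p) ?d = 0"
      using p d by blast
    then have "shifted l (u - p) ?d = 0"
      using D.polarize_eq[of "u - p" ?d] pD u wD by simp
    moreover have "shifted l w ?d = 0"
      using d w wD D.hermitian[of ?d w] by (simp add: S)
    ultimately have "shifted l ?d ?d = 0"
      using pD u wD by (simp add: D.diff_left)
    moreover have "?d \<in> D"
      using d by (simp add: S)
    ultimately have "?d = 0"
      by (intro shifted_definite[OF l])
    then show "p = u - w" by simp
  qed
  then show ?thesis
    by (simp add: kerJ_projection_def form_projection_def S_def kerJ_def)
qed

text \<open>
  The element of minimal \<open>form_shift E l\<close> among those that \<open>J\<close> maps to \<open>y\<close>. By linearity of this right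
  inverse of \<open>J\<close>, the trace form is the pullback of the shifted form along it.
\<close>
definition lift :: "real \<Rightarrow> 'k \<Rightarrow> 'h"
  where "lift l y = kerJ_projection D E domJ J l (inv_into domJ J y)"

lemma lift:
  assumes "0 < l" "y \<in> J ` domJ"
  shows lift_domJ: "lift l y \<in> domJ" and J_lift: "J (lift l y) = y"
    and lift_orthogonal: "\<And>s. s \<in> kerJ \<Longrightarrow> shifted l (lift l y) s = 0"
proof -
  let ?u = "inv_into domJ J y"
  have u: "?u \<in> domJ" "J ?u = y"
    using assms(2) by (simp_all add: inv_into_into f_inv_into_f)
  obtain w where w: "w \<in> kerJ" "\<And>v. v \<in> kerJ \<Longrightarrow> shifted l (?u - w) v = 0"
    using kernel_component[OF assms(1), of ?u] u(1) domJ_D by blast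
  have eq: "lift l y = ?u - w"
    unfolding lift_def using u(1) domJ_D by (intro kerJ_projection_eq assms(1) w) auto
  show "lift l y \<in> domJ" "J (lift l y) = y" "\<And>s. s \<in> kerJ \<Longrightarrow> shifted l (lift l y) s = 0"
    using u w kerJ_domJ by (auto simp: eq kerJ_def J_diff csubspace_diff[OF subspace])
qed

text \<open>
  The difference of two candidates lies in the kernel of \<open>J\<close> and is orthogonal to that kernel.
\<close>
lemma lift_eqI:
  assumes "0 < l" "u \<in> domJ" "J u = y" "\<And>s. s \<in> kerJ \<Longrightarrow> shifted l u s = 0"
  shows "lift l y = u"
proof -
  interpret D: positive_sesquilinear D "shifted l" "form_shift E l"
    by (rule shifted_form) (use assms in simp)
  have y: "y \<in> J ` domJ" using assms by blast
  note L = lift[OF assms(1) y]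
  let ?d = "lift l y - u"
  have d: "?d \<in> kerJ"
    using L assms by (simp add: kerJ_def J_diff csubspace_diff[OF subspace])
  then have "shifted l ?d ?d = 0"
    using L(1) L(3)[OF d] assms(2) assms(4)[OF d] domJ_D
    by (subst D.diff_left) (auto simp: subset_iff)
  then have "?d = 0"
    using d kerJ_domJ domJ_D by (intro shifted_definite[OF assms(1)]) auto
  then show ?thesis by simp
qed

lemma clinear_on_lift:
  assumes "0 < l"
  shows "clinear_on (J ` domJ) (lift l)"
proof -
  interpret D: positive_sesquilinear D "shifted l" "form_shift E l"
    by (rule shifted_form) (use assms in simp)
  note L = lift[OF assms]
  have N: "s \<in> D" if "s \<in> kerJ" for s using that kerJ_domJ domJ_D by blast
  have LD: "lift l y \<in> D" if "y \<in> J ` domJ" for y using L(1)[OF that] domJ_D by blast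
  have "lift l (x + y) = lift l x + lift l y" if "x \<in> J ` domJ" "y \<in> J ` domJ" for x y
    using that by (intro lift_eqI assms)
      (simp_all add: L LD N csubspace_add[OF subspace] clinear_on_add[OF linear] D.expand)
  moreover have "lift l (scaleC c x) = scaleC c (lift l x)" if "x \<in> J ` domJ" for x c
    using that by (intro lift_eqI assms)
      (simp_all add: L LD N csubspace_scaleC[OF subspace] clinear_on_scaleC[OF linear] D.expand)
  ultimately show ?thesis
    by (simp add: clinear_on_def)
qed

text \<open>
  On the right, \<open>v\<close> may replace \<open>lift l (J v)\<close>: they differ by an element of the kernel of \<open>J\<close>, to which
  \<open>lift l x\<close> is orthogonal.
\<close>
lemma polarize_trace_form:
  assumes "0 < l" "x \<in> J ` domJ" "v \<in> domJ"
  shows "polarize (trace_form D E domJ J l) x (J v) = shifted l (lift l x) v"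
proof -
  interpret D: positive_sesquilinear D "shifted l" "form_shift E l"
    by (rule shifted_form) (use assms in simp)
  note L = lift[OF assms(1)]
  have "lift l ` (J ` domJ) \<subseteq> D"
    using L(1) domJ_D by blast
  then interpret T: positive_sesquilinear "J ` domJ"
      "\<lambda>x y. shifted l (lift l x) (lift l y)" "trace_form D E domJ J l"
    using D.pullback[OF csubspace_image[OF subspace linear] clinear_on_lift[OF assms(1)]]
    by (simp add: trace_form_def[abs_def] lift_def[abs_def])
  have Jv: "J v \<in> J ` domJ" using assms(3) by simp
  have "v - lift l (J v) \<in> kerJ"
    using L(1,2)[OF Jv] assms(3) by (simp add: kerJ_def J_diff csubspace_diff[OF subspace])
  then have "shifted l (lift l x) (v - lift l (J v)) = 0"
    by (rule L(3)[OF assms(2)])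
  moreover have "lift l x \<in> D" "lift l (J v) \<in> D" "v \<in> D"
    using L(1)[OF assms(2)] L(1)[OF Jv] assms(3) domJ_D by auto
  ultimately show ?thesis
    using assms(2) Jv by (simp add: T.polarize_eq D.diff_right)
qed

text \<open>
  This eliminates the projection from the trace operator. A \<open>u\<close> as on the right-hand side is
  orthogonal to the kernel of \<open>J\<close>, as one sees by testing with \<open>v\<close> in the kernel.
\<close>
lemma trace_operator_iff:
  assumes "0 < l"
  shows "(x, g) \<in> trace_operator D E domJ J l \<longleftrightarrow>
    (\<exists>u\<in>domJ. J u = x \<and> (\<forall>v\<in>domJ. shifted l u v = cinner g (J v)))"
    (is "?lhs \<longleftrightarrow> ?rhs")
proof
  assume ?lhs
  then have x: "x \<in> J ` domJ" and "\<forall>v\<in>domJ. polarize (trace_form D E domJ J l) x (J v) = cinner g (J v)"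
    by (auto simp: trace_operator_def form_operator_def)
  then have "\<forall>v\<in>domJ. shifted l (lift l x) v = cinner g (J v)"
    using polarize_trace_form[OF assms x] by simp
  then show ?rhs
    using lift[OF assms x] by blast
next
  assume ?rhs
  then obtain u where u: "u \<in> domJ" "J u = x" "\<And>v. v \<in> domJ \<Longrightarrow> shifted l u v = cinner g (J v)"
    by blast
  have "cinner g 0 = 0" using cinner.diff_right[of 0 0 g] by simp
  then have "lift l x = u"
    using u kerJ_domJ by (intro lift_eqI assms) (auto simp: kerJ_def)
  moreover have x: "x \<in> J ` domJ" using u by blast
  ultimately show ?lhs
    using u polarize_trace_form[OF assms x]
    by (auto simp: trace_operator_def form_operator_def)
qed

lemma resolvent_trace_operator:
  assumes "0 < l"
  shows "resolvent1 (trace_operator D E domJ J l) f = J (solution l f)"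
  unfolding resolvent1_def
proof (rule the_equality)
  have "shifted l (solution l f) v = cinner (f - J (solution l f)) (J v)" if "v \<in> domJ" for v
    using solution(2)[OF assms that, of f] by (simp add: penalized_def cinner.diff_left algebra_simps)
  then show "(J (solution l f), f - J (solution l f)) \<in> trace_operator D E domJ J l"
    using solution(1)[OF assms] by (auto simp: trace_operator_iff[OF assms])
next
  fix x assume "(x, f - x) \<in> trace_operator D E domJ J l"
  then obtain u where u: "u \<in> domJ" "J u = x"
    "\<And>v. v \<in> domJ \<Longrightarrow> shifted l u v = cinner (f - x) (J v)"
    by (auto simp: trace_operator_iff[OF assms])
  then have "u = solution l f"
    by (intro solution_unique assms) (simp_all add: penalized_def cinner.diff_left)
  then show "x = J (solution l f)" using u by simp
qed

section \<open>The limit of the resolvents\<close>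

text \<open>
  The negative of the minimum over \<open>domJ\<close> of \<open>penalty l u - 2 Re (f, J u)\<close>, attained at
  \<open>solution l f\<close>.
\<close>
definition energy :: "real \<Rightarrow> 'k \<Rightarrow> real"
  where "energy l f = penalty l (solution l f)"

lemma cinner_solution:
  assumes "0 < l"
  shows "cinner f (J (solution l f)) = complex_of_real (energy l f)"
  using solution(2)[OF assms solution(1)[OF assms], of f f] solution(1)[OF assms, of f]
    positive_sesquilinear.diagonal[OF penalized_form, of l "solution l f"] assms
  by (simp add: energy_def)

lemma energy_parts:
  assumes "0 < l"
  shows "energy l f = E (solution l f) + l * (norm (solution l f))\<^sup>2 + (norm (J (solution l f)))\<^sup>2"
    and "0 \<le> E (solution l f)"
  using E_nonneg[of "solution l f"] solution(1)[OF assms, of f] domJ_D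
  by (auto simp: energy_def penalty_def form_shift_def)

lemma norm_J_solution_le:
  assumes "0 < l"
  shows "(norm (J (solution l f)))\<^sup>2 \<le> energy l f"
  using energy_parts[OF assms, of f] assms by simp

lemma energy_le:
  assumes "0 < l"
  shows "energy l f \<le> (norm f)\<^sup>2"
proof -
  let ?x = "J (solution l f)"
  have le: "energy l f \<le> norm f * norm ?x"
    using cmod_cinner_le[of f ?x] cinner_solution[OF assms, of f] by simp
  then have "norm ?x * norm ?x \<le> norm f * norm ?x"
    using norm_J_solution_le[OF assms, of f] by (simp add: power2_eq_square)
  then have "norm ?x \<le> norm f"
    by (cases "norm ?x = 0") simp_all
  then have "norm f * norm ?x \<le> norm f * norm f"
    by (intro mult_left_mono) simp_all
  then show ?thesis
    using le by (simp add: power2_eq_square)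
qed

text \<open>
  The functional \<open>penalty m u - 2 Re (f, J u)\<close> is quadratic with minimizer \<open>solution m f\<close>, so the first
  term is its excess over the minimum at \<open>solution l f\<close>. The second term is the decrease of the
  functional at that point when \<open>l\<close> is replaced by \<open>m\<close>.
\<close>
lemma energy_difference:
  assumes "0 < m" "0 < l"
  shows "penalty m (solution m f - solution l f) + (l - m) * (norm (solution l f))\<^sup>2
    = energy m f - energy l f"
proof -
  interpret P: positive_sesquilinear domJ "penalized m" "penalty m"
    by (rule penalized_form) (use assms in simp)
  have "penalty m (solution m f - solution l f) = energy m f
      - 2 * Re (penalized m (solution m f) (solution l f)) + penalty m (solution l f)"
    using solution(1) assms by (simp add: P.q_diff energy_def)
  moreover have "penalized m (solution m f) (solution l f) = complex_of_real (energy l f)"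
    using solution(2)[OF assms(1) solution(1)[OF assms(2)]] cinner_solution[OF assms(2)] by simp
  moreover have "penalty m (solution l f) = energy l f - (l - m) * (norm (solution l f))\<^sup>2"
    by (simp add: energy_def penalty_def form_shift_def algebra_simps)
  ultimately show ?thesis
    by simp
qed

lemma solution_difference:
  assumes "0 < m" "m \<le> l"
  shows "E (solution m f - solution l f) + (norm (J (solution m f) - J (solution l f)))\<^sup>2
    \<le> energy m f - energy l f"
proof -
  have l: "0 < l" using assms by simp
  have "0 \<le> m * (norm (solution m f - solution l f))\<^sup>2" "0 \<le> (l - m) * (norm (solution l f))\<^sup>2"
    using assms by simp_all
  then show ?thesis
    using energy_difference[OF assms(1) l, of f] solution(1)[OF assms(1), of f] solution(1)[OF l, of f]
    by (simp add: penalty_def form_shift_def J_diff)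
qed

lemma E_difference_nonneg: "u \<in> domJ \<Longrightarrow> v \<in> domJ \<Longrightarrow> 0 \<le> E (u - v)"
  using csubspace_diff[OF subspace] domJ_D by (intro E_nonneg) blast

text \<open>The functional minimized by \<open>solution l f\<close> increases with \<open>l\<close>, and so does its minimum.\<close>
lemma energy_antimono:
  assumes "0 < m" "m \<le> l"
  shows "energy l f \<le> energy m f"
proof -
  have "0 \<le> E (solution m f - solution l f)"
    using assms by (intro E_difference_nonneg solution) auto
  then show ?thesis
    using solution_difference[OF assms, of f] zero_le_power2[of "norm (J (solution m f) - J (solution l f))"]
    by linarith
qed

definition limit_energy :: "'k \<Rightarrow> real"
  where "limit_energy f = (SUP l\<in>{0<..}. energy l f)"

lemma energy_le_limit_energy: "0 < l \<Longrightarrow> energy l f \<le> limit_energy f"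
  unfolding limit_energy_def using energy_le by (intro cSUP_upper bdd_aboveI2) auto

lemma energy_tendsto: "((\<lambda>l. energy l f) \<longlongrightarrow> limit_energy f) (at_right 0)"
proof (rule order_tendstoI)
  fix a assume "a < limit_energy f"
  then obtain l where l: "0 < l" "a < energy l f"
    unfolding limit_energy_def using energy_le
    by (subst (asm) less_cSUP_iff) (auto intro!: bdd_aboveI2)
  then have "a < energy m f" if "0 < m" "m < l" for m
    using energy_antimono[of m l f] that by simp
  then show "\<forall>\<^sub>F m in at_right 0. a < energy m f"
    using l(1) eventually_at_right_field by blast
next
  fix a assume "limit_energy f < a"
  then have "energy m f < a" if "0 < m" for m
    using energy_le_limit_energy[OF that, of f] by simp
  then show "\<forall>\<^sub>F m in at_right 0. energy m f < a"
    by (simp add: eventually_at_right_less eventually_at_filter)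
qed

text \<open>
  The values of \<open>l\<close> along which the solutions supply the sequence that an element of the
  Arendt-ter Elst operator requires.
\<close>
definition param :: "nat \<Rightarrow> real"
  where "param n = inverse (real (Suc n))"

lemma param_pos [simp]: "0 < param n"
  by (simp add: param_def)

lemma param_tendsto: "param \<longlonglongrightarrow> 0"
  unfolding param_def[abs_def] by (rule LIMSEQ_inverse_real_of_nat)

lemma param_at_right: "filterlim param (at_right 0) sequentially"
  by (simp add: filterlim_at param_tendsto less_imp_neq[OF param_pos, symmetric])

lemma eventually_param_le:
  assumes "0 < l"
  shows "\<forall>\<^sub>F n in sequentially. param n \<le> l"
  using order_tendstoD(2)[OF param_tendsto assms] by eventually_elim simp

text \<open>
  Along the sequence \<open>param\<close> the energies converge, so the estimate \<open>solution_difference\<close> makes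
  the values of \<open>J\<close> Cauchy. The same estimate transfers the convergence from the sequence to the
  full limit \<open>l \<down> 0\<close>.
\<close>
lemma J_solution_convergent: "\<exists>x. ((\<lambda>l. J (solution l f)) \<longlongrightarrow> x) (at_right 0)"
proof -
  let ?s = "\<lambda>n. J (solution (param n) f)"
  have en: "Cauchy (\<lambda>n. energy (param n) f)"
    using filterlim_compose[OF energy_tendsto param_at_right] by (rule LIMSEQ_imp_Cauchy)
  have dist_sq: "(dist (?s m) (?s n))\<^sup>2 \<le> dist (energy (param m) f) (energy (param n) f)" for m n
  proof -
    have *: "(norm (J (solution a f) - J (solution b f)))\<^sup>2 \<le> energy a f - energy b f"
      if "0 < a" "a \<le> b" for a b
      using solution_difference[OF that, of f]
        E_difference_nonneg[of "solution a f" "solution b f"] solution(1)[of _ f] that by fastforce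
    show ?thesis
    proof (cases "param m \<le> param n")
      case True
      then show ?thesis using *[of "param m" "param n"] by (simp add: dist_norm)
    next
      case False
      then show ?thesis using *[of "param n" "param m"] by (simp add: dist_norm norm_minus_commute)
    qed
  qed
  have "Cauchy ?s"
  proof (rule metric_CauchyI)
    fix e :: real assume "0 < e"
    then have "0 < e\<^sup>2" by simp
    from metric_CauchyD[OF en this] obtain N
      where "\<And>m n. m \<ge> N \<Longrightarrow> n \<ge> N \<Longrightarrow> dist (energy (param m) f) (energy (param n) f) < e\<^sup>2"
      by blast
    then have "dist (?s m) (?s n) < e" if "m \<ge> N" "n \<ge> N" for m n
      using dist_sq[of m n] that \<open>0 < e\<close>
      by (meson less_imp_le order_le_less_trans power_less_imp_less_base)
    then show "\<exists>M. \<forall>m\<ge>M. \<forall>n\<ge>M. dist (?s m) (?s n) < e" by blast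
  qed
  then obtain x where x: "?s \<longlonglongrightarrow> x"
    by (auto simp: Cauchy_convergent_iff convergent_def)
  have le: "norm (J (solution l f) - x) \<le> sqrt (limit_energy f - energy l f)" if "0 < l" for l
  proof (rule real_le_rsqrt, rule LIMSEQ_le_const2)
    show "(\<lambda>n. (norm (J (solution l f) - ?s n))\<^sup>2) \<longlonglongrightarrow> (norm (J (solution l f) - x))\<^sup>2"
      by (intro tendsto_intros x)
    have "(norm (J (solution l f) - ?s n))\<^sup>2 \<le> limit_energy f - energy l f" if "param n \<le> l" for n
      using solution_difference[OF param_pos that, of f] energy_le_limit_energy[OF param_pos, of n f]
        E_difference_nonneg[OF solution(1)[OF param_pos] solution(1)[OF \<open>0 < l\<close>], of n f f]
      by (simp add: norm_minus_commute)
    then show "\<exists>N. \<forall>n\<ge>N. (norm (J (solution l f) - ?s n))\<^sup>2 \<le> limit_energy f - energy l f"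
      using eventually_param_le[OF that] unfolding eventually_sequentially by blast
  qed
  have "((\<lambda>l. J (solution l f) - x) \<longlongrightarrow> 0) (at_right 0)"
  proof (rule Lim_null_comparison)
    show "\<forall>\<^sub>F l in at_right 0. norm (J (solution l f) - x) \<le> sqrt (limit_energy f - energy l f)"
      using le by (simp add: eventually_at_filter)
    have "((\<lambda>l. sqrt (limit_energy f - energy l f)) \<longlongrightarrow> sqrt (limit_energy f - limit_energy f)) (at_right 0)"
      by (intro tendsto_intros energy_tendsto)
    then show "((\<lambda>l. sqrt (limit_energy f - energy l f)) \<longlongrightarrow> 0) (at_right 0)" by simp
  qed
  then have "((\<lambda>l. J (solution l f)) \<longlongrightarrow> x) (at_right 0)"
    by (rule LIM_zero_cancel)
  then show ?thesis ..
qed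

definition R :: "'k \<Rightarrow> 'k"
  where "R f = Lim (at_right 0) (\<lambda>l. J (solution l f))"

lemma J_solution_tendsto: "((\<lambda>l. J (solution l f)) \<longlongrightarrow> R f) (at_right 0)"
  using J_solution_convergent[of f] tendsto_Lim[OF trivial_limit_at_right_real]
  unfolding R_def by metis

lemma J_solution_param: "(\<lambda>n. J (solution (param n) f)) \<longlonglongrightarrow> R f"
  by (rule filterlim_compose[OF J_solution_tendsto param_at_right])

lemma cinner_R: "cinner f (R f) = complex_of_real (limit_energy f)"
proof (rule tendsto_unique[OF trivial_limit_at_right_real])
  show "((\<lambda>l. cinner f (J (solution l f))) \<longlongrightarrow> cinner f (R f)) (at_right 0)"
    by (intro tendsto_cinner tendsto_const J_solution_tendsto)
  have "((\<lambda>l. complex_of_real (energy l f)) \<longlongrightarrow> complex_of_real (limit_energy f)) (at_right 0)"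
    by (intro tendsto_of_real energy_tendsto)
  then show "((\<lambda>l. cinner f (J (solution l f))) \<longlongrightarrow> complex_of_real (limit_energy f)) (at_right 0)"
    by (rule Lim_transform_eventually) (simp add: eventually_at_filter cinner_solution)
qed

lemma norm_R_le: "(norm (R f))\<^sup>2 \<le> limit_energy f"
proof (rule tendsto_upperbound)
  show "((\<lambda>l. (norm (J (solution l f)))\<^sup>2) \<longlongrightarrow> (norm (R f))\<^sup>2) (at_right 0)"
    by (intro tendsto_intros J_solution_tendsto)
  have "(norm (J (solution l f)))\<^sup>2 \<le> limit_energy f" if "0 < l" for l
    using norm_J_solution_le[OF that, of f] energy_le_limit_energy[OF that, of f] by linarith
  then show "\<forall>\<^sub>F l in at_right 0. (norm (J (solution l f)))\<^sup>2 \<le> limit_energy f"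
    by (simp add: eventually_at_filter)
qed (rule trivial_limit_at_right_real)

text \<open>
  If \<open>R f = 0\<close>, the limit of the energies vanishes. Since energies only increase on the way to that
  limit, they vanish identically; so do the solutions, and the equation for \<open>solution 1 f\<close> reads
  \<open>(f, J v) = 0\<close>.
\<close>
lemma R_eq_zero_imp:
  assumes "R f = 0"
  shows "f = 0"
proof (rule dense_orthogonal_zero[OF dense])
  interpret P: positive_sesquilinear domJ "penalized 1" "penalty 1"
    by (rule penalized_form) simp
  let ?u = "solution 1 f"
  have u: "?u \<in> domJ" by (rule solution) simp
  have "limit_energy f = 0"
    using cinner_R[of f] cinner.diff_right[of 0 0 f] assms by simp
  then have "penalty 1 ?u = 0"
    using energy_le_limit_energy[of 1 f] P.nonneg[OF u] by (simp add: energy_def)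
  then have zero: "?u = 0"
    using u by (intro penalized_definite[of 1]) (simp_all add: P.diagonal)
  fix y assume "y \<in> J ` domJ"
  then obtain v where v: "v \<in> domJ" "y = J v" by blast
  then show "cinner f y = 0"
    using solution(2)[of 1 v f] zero P.zero_left[OF v(1)] by simp
qed

section \<open>The operator associated with the form and \<open>J\<close>\<close>

abbreviation A :: "('k \<times> 'k) set"
  where "A \<equiv> arendt_ter_elst_operator domJ (polarize E) J"

text \<open>
  In the equation for \<open>solution l f\<close> the term \<open>l (u, v)\<close> disappears in the limit although \<open>u\<close> itself
  may be unbounded: the energy bounds \<open>l |u|\<^sup>2\<close>, so \<open>l |u|\<close> is of order \<open>sqrt l\<close>.
\<close>
lemma form_solution_tendsto:
  assumes v: "v \<in> domJ"
  shows "(\<lambda>n. polarize E (solution (param n) f) v) \<longlonglongrightarrow> cinner (f - R f) (J v)"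
proof -
  let ?u = "\<lambda>n. solution (param n) f"
  have eq: "cinner (f - J (?u n)) (J v) - complex_of_real (param n) * cinner (?u n) v
      = polarize E (?u n) v" for n
    using solution(2)[OF param_pos v, of n f]
    by (simp add: penalized_def shifted_def cinner.diff_left algebra_simps)
  have "(\<lambda>n. complex_of_real (param n) * cinner (?u n) v) \<longlonglongrightarrow> 0"
  proof (rule Lim_null_comparison)
    have "cmod (complex_of_real (param n) * cinner (?u n) v)
        \<le> sqrt (param n) * (norm f * norm v)" for n
    proof -
      have "param n * (norm (?u n))\<^sup>2 \<le> energy (param n) f"
        using energy_parts[OF param_pos, of n f] by simp
      also have "\<dots> \<le> (norm f)\<^sup>2"
        by (rule energy_le) simp
      finally have "sqrt (param n) * norm (?u n) \<le> norm f"
        using real_sqrt_le_mono[of "param n * (norm (?u n))\<^sup>2" "(norm f)\<^sup>2"]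
        by (simp add: real_sqrt_mult)
      then have "sqrt (param n) * (sqrt (param n) * norm (?u n) * norm v)
          \<le> sqrt (param n) * (norm f * norm v)"
        by (intro mult_left_mono mult_right_mono) (simp_all add: less_imp_le)
      moreover have "sqrt (param n) * (sqrt (param n) * norm (?u n) * norm v)
          = param n * (norm (?u n) * norm v)"
        by (simp add: abs_of_pos)
      moreover have "cmod (complex_of_real (param n) * cinner (?u n) v)
          \<le> param n * (norm (?u n) * norm v)"
        using cmod_cinner_le[of "?u n" v] param_pos[of n]
        by (simp add: norm_mult mult_left_mono less_imp_le)
      ultimately show ?thesis by linarith
    qed
    then show "\<forall>\<^sub>F n in sequentially. cmod (complex_of_real (param n) * cinner (?u n) v)
        \<le> sqrt (param n) * (norm f * norm v)" by simp
    have "(\<lambda>n. sqrt (param n) * (norm f * norm v)) \<longlonglongrightarrow> sqrt 0 * (norm f * norm v)"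
      by (intro tendsto_intros param_tendsto)
    then show "(\<lambda>n. sqrt (param n) * (norm f * norm v)) \<longlonglongrightarrow> 0" by simp
  qed
  moreover have "(\<lambda>n. cinner (f - J (?u n)) (J v)) \<longlonglongrightarrow> cinner (f - R f) (J v)"
    by (intro tendsto_cinner tendsto_intros J_solution_param)
  ultimately have "(\<lambda>n. cinner (f - J (?u n)) (J v) - complex_of_real (param n) * cinner (?u n) v)
      \<longlonglongrightarrow> cinner (f - R f) (J v) - 0"
    by (intro tendsto_diff)
  then show ?thesis by (simp add: eq)
qed

lemma graph_R_subset: "(R f, f - R f) \<in> A"
proof -
  interpret F: positive_sesquilinear domJ "polarize E" E by (rule form_domJ)
  let ?u = "\<lambda>n. solution (param n) f"
  have u: "?u n \<in> domJ" for n by (rule solution) simp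
  have "E (?u n) \<le> (norm f)\<^sup>2" for n
  proof -
    have "0 \<le> param n * (norm (?u n))\<^sup>2" by (simp add: less_imp_le)
    then show ?thesis
      using energy_parts(1)[OF param_pos, of n f] energy_le[OF param_pos, of n f]
        zero_le_power2[of "norm (J (?u n))"] by linarith
  qed
  then have "bdd_above (range (\<lambda>n. Re (polarize E (?u n) (?u n))))"
    using u by (intro bdd_aboveI2[where M = "(norm f)\<^sup>2"]) (simp add: F.diagonal)
  moreover have "weakly_tendsto (\<lambda>n. J (?u n)) (R f)"
    unfolding weakly_tendsto_def by (intro allI tendsto_cinner tendsto_const J_solution_param)
  ultimately show ?thesis
    unfolding arendt_ter_elst_operator_def
    using u form_solution_tendsto[of _ f]
    by (intro CollectI case_prodI exI[of _ ?u] conjI) auto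
qed

text \<open>
  This is the interchange of limits. For the solutions \<open>v\<close> belonging to \<open>g\<close> and a sequence \<open>u\<close> witnessing
  \<open>(x, f) \<in> A\<close>, the values \<open>polarize E v (u n)\<close> tend to \<open>(J v, f)\<close> as \<open>n \<rightarrow> \<infinity>\<close> and to
  \<open>(g - R g, J (u n))\<close> as \<open>l \<rightarrow> 0\<close>. The second convergence is uniform in \<open>n\<close>, by the Cauchy-Schwarz
  inequality for \<open>E\<close> and the bound on \<open>E (u n)\<close>.
\<close>
lemma A_imp_cinner_R:
  assumes "(x, f) \<in> A"
  shows "cinner (R g) (f + x) = cinner g x"
proof -
  interpret F: positive_sesquilinear domJ "polarize E" E by (rule form_domJ)
  obtain u :: "nat \<Rightarrow> 'h" where u: "\<And>n. u n \<in> domJ"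
    and weak: "weakly_tendsto (\<lambda>n. J (u n)) x"
    and bdd: "bdd_above (range (\<lambda>n. Re (polarize E (u n) (u n))))"
    and lim: "\<And>v. v \<in> domJ \<Longrightarrow> (\<lambda>n. polarize E (u n) v) \<longlonglongrightarrow> cinner f (J v)"
    using assms by (auto simp: arendt_ter_elst_operator_def)
  obtain C where C: "\<And>n. E (u n) \<le> C"
    using bdd u by (auto simp: bdd_above_def F.diagonal)
  have uniform: "(cmod (polarize E (solution l g) (u n) - cinner (g - R g) (J (u n))))\<^sup>2
      \<le> (limit_energy g - energy l g) * C" if l: "0 < l" for l n
  proof (rule LIMSEQ_le_const2)
    let ?w = "\<lambda>k. solution (param k) g"
    let ?v = "solution l g"
    show "(\<lambda>k. (cmod (polarize E ?v (u n) - polarize E (?w k) (u n)))\<^sup>2)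
        \<longlonglongrightarrow> (cmod (polarize E ?v (u n) - cinner (g - R g) (J (u n))))\<^sup>2"
      by (intro tendsto_intros form_solution_tendsto u)
    have "(cmod (polarize E ?v (u n) - polarize E (?w k) (u n)))\<^sup>2 \<le> (limit_energy g - energy l g) * C"
      if "param k \<le> l" for k
    proof -
      have mem: "?v \<in> domJ" "?w k \<in> domJ" using l by (auto intro: solution)
      have E_le: "E (?w k - ?v) \<le> limit_energy g - energy l g"
        using solution_difference[OF param_pos that, of g] energy_le_limit_energy[OF param_pos, of k g]
          zero_le_power2[of "norm (J (?w k) - J ?v)"] by linarith
      have "(cmod (polarize E ?v (u n) - polarize E (?w k) (u n)))\<^sup>2
          = (cmod (polarize E (?w k - ?v) (u n)))\<^sup>2"
        using mem u by (simp add: F.diff_left norm_minus_commute)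
      also have "\<dots> \<le> E (?w k - ?v) * E (u n)"
        using mem u by (intro F.cauchy_schwarz) auto
      also have "\<dots> \<le> (limit_energy g - energy l g) * C"
        using E_le C[of n] F.nonneg[of "?w k - ?v"] F.nonneg[OF u] mem
        by (intro mult_mono) auto
      finally show ?thesis .
    qed
    then show "\<exists>K. \<forall>k\<ge>K. (cmod (polarize E ?v (u n) - polarize E (?w k) (u n)))\<^sup>2
        \<le> (limit_energy g - energy l g) * C"
      using eventually_param_le[OF l] unfolding eventually_sequentially by blast
  qed
  have limit_n: "(cmod (cinner (J (solution l g)) f - cinner (g - R g) x))\<^sup>2
      \<le> (limit_energy g - energy l g) * C" if l: "0 < l" for l
  proof (rule LIMSEQ_le_const2)
    let ?v = "solution l g"
    have v: "?v \<in> domJ" using l by (rule solution)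
    have "(\<lambda>n. cnj (polarize E (u n) ?v)) \<longlonglongrightarrow> cnj (cinner f (J ?v))"
      by (intro tendsto_cnj lim v)
    then have 1: "(\<lambda>n. polarize E ?v (u n)) \<longlonglongrightarrow> cinner (J ?v) f"
      using F.hermitian[OF u v] cinner_commute[of "J ?v" f] by simp
    have "(\<lambda>n. cnj (cinner (J (u n)) (g - R g))) \<longlonglongrightarrow> cnj (cinner x (g - R g))"
      using weak by (intro tendsto_cnj) (simp add: weakly_tendsto_def)
    then have 2: "(\<lambda>n. cinner (g - R g) (J (u n))) \<longlonglongrightarrow> cinner (g - R g) x"
      by (simp flip: cinner_commute)
    show "(\<lambda>n. (cmod (polarize E ?v (u n) - cinner (g - R g) (J (u n))))\<^sup>2)
        \<longlonglongrightarrow> (cmod (cinner (J ?v) f - cinner (g - R g) x))\<^sup>2"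
      by (intro tendsto_intros 1 2)
    show "\<exists>N. \<forall>n\<ge>N. (cmod (polarize E ?v (u n) - cinner (g - R g) (J (u n))))\<^sup>2
        \<le> (limit_energy g - energy l g) * C"
      using uniform[OF l] by blast
  qed
  have "(cmod (cinner (R g) f - cinner (g - R g) x))\<^sup>2 \<le> (limit_energy g - limit_energy g) * C"
  proof (rule tendsto_le[OF trivial_limit_at_right_real])
    show "((\<lambda>l. (cmod (cinner (J (solution l g)) f - cinner (g - R g) x))\<^sup>2)
        \<longlongrightarrow> (cmod (cinner (R g) f - cinner (g - R g) x))\<^sup>2) (at_right 0)"
      by (intro tendsto_power tendsto_norm tendsto_diff tendsto_cinner tendsto_const J_solution_tendsto)
    show "((\<lambda>l. (limit_energy g - energy l g) * C)
        \<longlongrightarrow> (limit_energy g - limit_energy g) * C) (at_right 0)"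
      by (intro tendsto_intros energy_tendsto)
    show "\<forall>\<^sub>F l in at_right 0. (cmod (cinner (J (solution l g)) f - cinner (g - R g) x))\<^sup>2
        \<le> (limit_energy g - energy l g) * C"
      using limit_n by (simp add: eventually_at_filter)
  qed
  then show ?thesis
    by (simp add: cinner.diff_left cinner.add_right)
qed

text \<open>Every \<open>h\<close> is of the form \<open>f + x\<close> with \<open>(x, f) \<in> A\<close> and \<open>x = R h\<close>.\<close>
lemma R_symmetric: "cinner (R g) h = cinner g (R h)"
  using A_imp_cinner_R[OF graph_R_subset, of g h] by simp

lemma A_iff: "(x, f) \<in> A \<longleftrightarrow> R (f + x) = x"
proof
  assume "(x, f) \<in> A"
  then have "cinner g (R (f + x)) = cinner g x" for g
    using A_imp_cinner_R R_symmetric by metis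
  then show "R (f + x) = x"
    by (rule cinner_eqI)
next
  assume "R (f + x) = x"
  then show "(x, f) \<in> A"
    using graph_R_subset[of "f + x"] by simp
qed

lemma R_add: "R (f + g) = R f + R g"
  by (rule cinner_eqI) (simp add: cinner.add_right flip: R_symmetric)

lemma R_scaleC: "R (scaleC c f) = scaleC c (R f)"
  by (rule cinner_eqI) (simp add: cinner.scale_right flip: R_symmetric)

lemma R_diff: "R (f - g) = R f - R g"
  by (rule cinner_eqI) (simp add: cinner.diff_right flip: R_symmetric)

text \<open>The orthogonal complement of the range of a symmetric operator is its kernel.\<close>
lemma dense_range_R: "closure (range R) = UNIV"
proof (rule closure_eq_UNIV_if_orthogonal_zero)
  show "csubspace (range R)"
    by (rule csubspace_image[OF csubspace_UNIV]) (simp add: clinear_on_def R_add R_scaleC)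
  fix x assume "\<And>s. s \<in> range R \<Longrightarrow> cinner x s = 0"
  then have "cinner (R x) (R x) = 0"
    using R_symmetric[of x "R x"] by simp
  then show "x = 0"
    by (simp add: cinner_norm R_eq_zero_imp)
qed

lemma positive_self_adjoint_A: "positive_self_adjoint A"
proof -
  have single: "single_valued A"
  proof (rule single_valuedI)
    fix x f g assume "(x, f) \<in> A" "(x, g) \<in> A"
    then have "R (f + x) = x" "R (g + x) = x"
      by (simp_all only: A_iff)
    then have "R ((f + x) - (g + x)) = 0"
      unfolding R_diff by simp
    then show "f = g"
      using R_eq_zero_imp by fastforce
  qed
  have "range R \<subseteq> Domain A"
    using graph_R_subset by blast
  then have dom: "closure (Domain A) = UNIV"
    using dense_range_R closure_mono by blast
  have adj: "adjoint_graph A = A"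
  proof (intro set_eqI iffI; clarify)
    fix y z assume yz: "(y, z) \<in> adjoint_graph A"
    have "cinner f (R (z + y)) = cinner f y" for f
    proof -
      have "cinner (f - R f) y = cinner (R f) z"
        using yz graph_R_subset[of f] by (auto simp: adjoint_graph_def)
      then show ?thesis
        using R_symmetric[of f "z + y"] by (simp add: cinner.diff_left cinner.add_right algebra_simps)
    qed
    then show "(y, z) \<in> A"
      unfolding A_iff by (rule cinner_eqI)
  next
    fix y z assume yz: "(y, z) \<in> A"
    have "cinner w y = cinner x z" if "(x, w) \<in> A" for x w
    proof -
      have "R (w + x) = x"
        using that by (simp only: A_iff)
      then show ?thesis
        using A_imp_cinner_R[OF yz, of "w + x"] by (simp add: cinner.add_left cinner.add_right)
    qed
    then show "(y, z) \<in> adjoint_graph A"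
      by (auto simp: adjoint_graph_def)
  qed
  have "cinner f x \<in> \<real> \<and> 0 \<le> Re (cinner f x)" if "(x, f) \<in> A" for x f
  proof -
    let ?h = "f + x"
    have x: "R ?h = x" using that by (simp only: A_iff)
    have "cinner f x = cinner ?h x - cinner x x"
      by (simp add: cinner.add_left)
    also have "cinner ?h x = complex_of_real (limit_energy ?h)"
      using cinner_R[of ?h] x by simp
    finally have "cinner f x = complex_of_real (limit_energy ?h - (norm x)\<^sup>2)"
      by (simp add: cinner_norm)
    moreover have "(norm x)\<^sup>2 \<le> limit_energy ?h"
      using norm_R_le[of ?h] x by simp
    ultimately show ?thesis by simp
  qed
  then show ?thesis
    using single dom adj by (auto simp: positive_self_adjoint_def self_adjoint_def)
qed

lemma resolvent_tendsto:
  "((\<lambda>l. resolvent1 (trace_operator D E domJ J l) f) \<longlongrightarrow> R f) (at_right 0)"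
  by (rule Lim_transform_eventually[OF J_solution_tendsto])
    (simp add: eventually_at_filter resolvent_trace_operator)

text \<open>
  For another candidate \<open>T\<close>, equality of the resolvents gives \<open>R (f + x) = x\<close> for each
  \<open>(x, f) \<in> T\<close>, that is, \<open>T \<subseteq> A\<close>. Self-adjointness of both operators turns the inclusion into
  equality.
\<close>
lemma limit_trace_operator_eq: "limit_trace_operator D E domJ J = A"
  unfolding limit_trace_operator_def
proof (rule the_equality)
  have "resolvent1 A f = R f" for f
    by (rule resolvent1_eqI[OF positive_self_adjoint_A graph_R_subset])
  then show "positive_self_adjoint A \<and>
      (\<forall>f. ((\<lambda>l. resolvent1 (trace_operator D E domJ J l) f) \<longlongrightarrow> resolvent1 A f) (at_right 0))"
    using positive_self_adjoint_A resolvent_tendsto by simp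
next
  fix T
  assume T: "positive_self_adjoint T \<and>
      (\<forall>f. ((\<lambda>l. resolvent1 (trace_operator D E domJ J l) f) \<longlongrightarrow> resolvent1 T f) (at_right 0))"
  then have res: "resolvent1 T f = R f" for f
    using tendsto_unique[OF trivial_limit_at_right_real _ resolvent_tendsto] by blast
  have "T \<subseteq> A"
  proof clarify
    fix x f assume "(x, f) \<in> T"
    then have "resolvent1 T (f + x) = x"
      using T by (intro resolvent1_eqI) auto
    then show "(x, f) \<in> A"
      using res by (simp add: A_iff)
  qed
  then show "T = A"
    using T positive_self_adjoint_A
    by (intro self_adjoint_maximal) (simp_all add: positive_self_adjoint_def)
qed

end

theorem theorem2p6:
  fixes D :: "'h::complex_hilbert_space set"
    and E :: "'h \<Rightarrow> real"
    and domJ :: "'h set"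
    and J :: "'h \<Rightarrow> 'k::complex_hilbert_space"
  assumes "positive_form D E"
    and "closed_form D E"
    and "csubspace domJ"
    and "domJ \<subseteq> D"
    and "clinear_on domJ J"
    and "closure (J ` domJ) = UNIV"
    and "form_closed_operator D E domJ J"
  shows "arendt_ter_elst_operator domJ (polarize E) J = limit_trace_operator D E domJ J"
proof -
  interpret trace_setting D E domJ J
    using assms by unfold_locales
  show ?thesis
    by (rule limit_trace_operator_eq[symmetric])
qed

end
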